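(* The exceptional half plane instanton $(\mathbb C^2,g,J)$ is a QCH Kähler surface of Calabi type.
   Context: Exceptional half plane instanton: on the set with coordinates $x>0$, $y\in\mathbb R$, $\theta_1\in\mathbb R/2\pi\mathbb Z$, $\theta_2\in\mathbb R$, let $$g=(1+x^2)(dx^2+dy^2)+\sum_{i,j=1}^2G^{ij}\,d\theta_i\,d\theta_j,\quad G^{11}=\frac{x^2}{1+x^2},\ \ G^{12}=G^{21}=\frac{2x^2y}{1+x^2},\ \ G^{22}=\frac{(1+x^2)^2+4x^2y^2}{1+x^2},$$ with Kähler form $$\omega_J=x\,dx\wedge d\theta_1+(1+x^2)\,dy\wedge d\theta_2+2xy\,dx\wedge d\theta_2,$$ and $J$ defined by $\omega_J(X,Y)=g(JX,Y)$. In the coordinates $x_1=x\cos\theta_1$, $y_1=x\sin\theta_1$, $x_2=y$, $y_2=\theta_2$ this Kähler structure extends smoothly across $x=0$ to all of $\mathbb R^4=\mathbb C^2$ (as a smooth manifold); the extension is the exceptional half plane instanton. QCH Kähler surface: a Kähler surface $(N,g,J)$ (real dimension 4) admitting a global 2-dimensional $J$-invariant distribution $\mathcal D\subset TN$ such that, for every $p\in N$ and every $J$-invariant 2-plane $\pi\subset T_pN$ with $X\in\pi$, $g(X,X)=1$, the holomorphic curvature $K(\pi)=R(X,JX,JX,X)$ depends only on the point $p$ and the number $|X_{\mathcal D}|=\sqrt{g(X_{\mathcal D},X_{\mathcal D})}$, where $X_{\mathcal D}$ is the orthogonal projection of $X$ onto $\mathcal D$. Its opposite almost Hermitian structure $I$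 is the $g$-orthogonal almost complex structure with $I=J$ on $\mathcal D$ and $I=-J$ on $\mathcal D^\perp$ (defined up to sign); its Kähler form $\omega_I(X,Y)=g(IX,Y)$ is anti-selfdual for the orientation of $J$. When $I$ is integrable, its Lee form $\theta$ is defined by $d\omega_I=2\theta\wedge\omega_I$. Calabi type Kähler surface: a QCH Kähler surface such that $I$ is integrable (Hermitian), $|\nabla I|>0$ everywhere, one of the distributions $\mathcal D,\mathcal D^\perp$ coincides with $\mathcal D_0=\operatorname{span}\{\theta^\sharp,I\theta^\sharp\}=\{X:\nabla_XI=0\}$ ("generalized Calabi type"), and in addition $(g,I)$ is locally conformally Kähler. A QCH Kähler surface $(N,g,J)$ is said to be of Calabi type if there is an open dense subset $U\subset N$ such that $(U,g|_U,J|_U)$ is a Calabi type Kähler surface in this sense. *)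

theory Defs
  imports "HOL-Analysis.Analysis"
begin

section \<open>Tensor calculus on open subsets of coordinate space\<close>

text \<open>
  All tensor fields live on an open set of \<open>real^'n\<close> and are given by their components in the
  standard coordinates. A bilinear form \<open>b\<close> is stored as the matrix \<open>b $ i $ j = b(e\<^sub>i, e\<^sub>j)\<close>,
  so that \<open>b(X, Y) = X \<bullet> (b *v Y)\<close>; an endomorphism \<open>A\<close> is stored as its matrix, acting by
  \<open>A *v X\<close>; a 1-form \<open>\<theta>\<close> is stored as the vector of its components. Fields are total functions;
  only their values on the open set at hand matter.
\<close>

definition pd :: "'n::finite \<Rightarrow> (real^'n \<Rightarrow> 'b::real_normed_vector) \<Rightarrow> real^'n \<Rightarrow> 'b" where
  "pd i f p = frechet_derivative f (at p) (axis i 1)"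

fun Ck_on :: "nat \<Rightarrow> (real^'n::finite) set \<Rightarrow> (real^'n \<Rightarrow> 'b::real_normed_vector) \<Rightarrow> bool" where
  "Ck_on 0 S f \<longleftrightarrow> continuous_on S f"
| "Ck_on (Suc k) S f \<longleftrightarrow> (\<forall>p\<in>S. f differentiable (at p)) \<and> (\<forall>i. Ck_on k S (pd i f))"

definition smooth_on :: "(real^'n::finite) set \<Rightarrow> (real^'n \<Rightarrow> 'b::real_normed_vector) \<Rightarrow> bool" where
  "smooth_on S f \<longleftrightarrow> (\<forall>k. Ck_on k S f)"

text \<open>Pullback of a bilinear form field along a map.\<close>

definition pullback ::
    "(real^'n::finite \<Rightarrow> real^'n) \<Rightarrow> (real^'n \<Rightarrow> real^'n^'n) \<Rightarrow> real^'n \<Rightarrow> real^'n^'n" where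
  "pullback F b q =
     transpose (jacobian F (at q)) ** b (F q) ** jacobian F (at q)"

subsection \<open>Riemannian metrics, Levi-Civita connection and curvature\<close>

definition metric_ip :: "(real^'n::finite \<Rightarrow> real^'n^'n) \<Rightarrow> real^'n \<Rightarrow> real^'n \<Rightarrow> real^'n \<Rightarrow> real" where
  "metric_ip g p X Y = X \<bullet> (g p *v Y)"

definition metric_norm :: "(real^'n::finite \<Rightarrow> real^'n^'n) \<Rightarrow> real^'n \<Rightarrow> real^'n \<Rightarrow> real" where
  "metric_norm g p X = sqrt (metric_ip g p X X)"

definition riemannian_on :: "(real^'n::finite) set \<Rightarrow> (real^'n \<Rightarrow> real^'n^'n) \<Rightarrow> bool" where
  "riemannian_on S g \<longleftrightarrow> open S \<and> smooth_on S g \<and>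
     (\<forall>p\<in>S. (\<forall>X Y. metric_ip g p X Y = metric_ip g p Y X) \<and>
            (\<forall>X. X \<noteq> 0 \<longrightarrow> metric_ip g p X X > 0))"

text \<open>\<open>christoffel g k i j\<close> is the symbol with upper index \<open>k\<close>: \<open>\<nabla>\<^sub>i e\<^sub>j = \<Sum>k. christoffel g k i j e\<^sub>k\<close>.\<close>

definition christoffel ::
    "(real^'n::finite \<Rightarrow> real^'n^'n) \<Rightarrow> 'n \<Rightarrow> 'n \<Rightarrow> 'n \<Rightarrow> real^'n \<Rightarrow> real" where
  "christoffel g k i j p =
     (\<Sum>l\<in>UNIV. matrix_inv (g p) $ k $ l *
        (pd i (\<lambda>q. g q $ j $ l) p + pd j (\<lambda>q. g q $ i $ l) p - pd l (\<lambda>q. g q $ i $ j) p)) / 2"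

text \<open>\<open>curv_coeff g l i j k\<close> is the \<open>e\<^sub>l\<close>-component of
  \<open>R(e\<^sub>i, e\<^sub>j)e\<^sub>k = \<nabla>\<^sub>i \<nabla>\<^sub>j e\<^sub>k - \<nabla>\<^sub>j \<nabla>\<^sub>i e\<^sub>k\<close>.\<close>

definition curv_coeff ::
    "(real^'n::finite \<Rightarrow> real^'n^'n) \<Rightarrow> 'n \<Rightarrow> 'n \<Rightarrow> 'n \<Rightarrow> 'n \<Rightarrow> real^'n \<Rightarrow> real" where
  "curv_coeff g l i j k p =
     pd i (christoffel g l j k) p - pd j (christoffel g l i k) p
     + (\<Sum>m\<in>UNIV. christoffel g l i m p * christoffel g m j k p
                 - christoffel g l j m p * christoffel g m i k p)"

text \<open>\<open>R(X, Y, Z, W) = g(R(X, Y)Z, W)\<close>, so that \<open>R(X, Y, Y, X)\<close> is the sectional curvature of an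
  orthonormal pair.\<close>

definition curv_op ::
    "(real^'n::finite \<Rightarrow> real^'n^'n) \<Rightarrow> real^'n \<Rightarrow> real^'n \<Rightarrow> real^'n \<Rightarrow> real^'n \<Rightarrow> real^'n" where
  "curv_op g p X Y Z =
     (\<chi> l. \<Sum>i\<in>UNIV. \<Sum>j\<in>UNIV. \<Sum>k\<in>UNIV. curv_coeff g l i j k p * X $ i * Y $ j * Z $ k)"

definition riem ::
    "(real^'n::finite \<Rightarrow> real^'n^'n) \<Rightarrow> real^'n \<Rightarrow> real^'n \<Rightarrow> real^'n \<Rightarrow> real^'n \<Rightarrow> real^'n \<Rightarrow> real" where
  "riem g p X Y Z W = metric_ip g p (curv_op g p X Y Z) W"

text \<open>Components \<open>(\<nabla>\<^sub>i A) e\<^sub>j = \<Sum>k. cov_endo_coeff g A k i j e\<^sub>k\<close> of the covariant derivative of an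
  endomorphism field, and its \<open>g\<close>-norm as a tensor.\<close>

definition cov_endo_coeff ::
    "(real^'n::finite \<Rightarrow> real^'n^'n) \<Rightarrow> (real^'n \<Rightarrow> real^'n^'n) \<Rightarrow> 'n \<Rightarrow> 'n \<Rightarrow> 'n \<Rightarrow> real^'n \<Rightarrow> real" where
  "cov_endo_coeff g A k i j p = pd i (\<lambda>q. A q $ k $ j) p
     + (\<Sum>a\<in>UNIV. christoffel g k i a p * A p $ a $ j - christoffel g a i j p * A p $ k $ a)"

definition cov_endo ::
    "(real^'n::finite \<Rightarrow> real^'n^'n) \<Rightarrow> (real^'n \<Rightarrow> real^'n^'n) \<Rightarrow> real^'n \<Rightarrow> real^'n \<Rightarrow> real^'n^'n" where
  "cov_endo g A p X = (\<chi> k j. \<Sum>i\<in>UNIV. X $ i * cov_endo_coeff g A k i j p)"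

definition cov_endo_norm ::
    "(real^'n::finite \<Rightarrow> real^'n^'n) \<Rightarrow> (real^'n \<Rightarrow> real^'n^'n) \<Rightarrow> real^'n \<Rightarrow> real" where
  "cov_endo_norm g A p = sqrt
     (\<Sum>i\<in>UNIV. \<Sum>i'\<in>UNIV. \<Sum>j\<in>UNIV. \<Sum>j'\<in>UNIV. \<Sum>k\<in>UNIV. \<Sum>k'\<in>UNIV.
        matrix_inv (g p) $ i $ i' * matrix_inv (g p) $ j $ j' * g p $ k $ k' *
        cov_endo_coeff g A k i j p * cov_endo_coeff g A k' i' j' p)"

subsection \<open>Differential forms\<close>

definition ext_d2 :: "(real^'n::finite \<Rightarrow> real^'n^'n) \<Rightarrow> 'n \<Rightarrow> 'n \<Rightarrow> 'n \<Rightarrow> real^'n \<Rightarrow> real" where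
  "ext_d2 \<omega> i j k p =
     pd i (\<lambda>q. \<omega> q $ j $ k) p + pd j (\<lambda>q. \<omega> q $ k $ i) p + pd k (\<lambda>q. \<omega> q $ i $ j) p"

definition wedge12 ::
    "(real^'n::finite \<Rightarrow> real^'n) \<Rightarrow> (real^'n \<Rightarrow> real^'n^'n) \<Rightarrow> 'n \<Rightarrow> 'n \<Rightarrow> 'n \<Rightarrow> real^'n \<Rightarrow> real" where
  "wedge12 \<theta> \<omega> i j k p =
     \<theta> p $ i * \<omega> p $ j $ k + \<theta> p $ j * \<omega> p $ k $ i + \<theta> p $ k * \<omega> p $ i $ j"

definition sharp :: "(real^'n::finite \<Rightarrow> real^'n^'n) \<Rightarrow> (real^'n \<Rightarrow> real^'n) \<Rightarrow> real^'n \<Rightarrow> real^'n" where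
  "sharp g \<theta> p = matrix_inv (g p) *v \<theta> p"

section \<open>Hermitian and Kaehler structures\<close>

text \<open>Components of \<open>[J e\<^sub>i, J e\<^sub>j] - J [J e\<^sub>i, e\<^sub>j] - J [e\<^sub>i, J e\<^sub>j]\<close> along \<open>e\<^sub>k\<close>.\<close>

definition nijenhuis :: "(real^'n::finite \<Rightarrow> real^'n^'n) \<Rightarrow> 'n \<Rightarrow> 'n \<Rightarrow> 'n \<Rightarrow> real^'n \<Rightarrow> real" where
  "nijenhuis J k i j p = (\<Sum>a\<in>UNIV.
       J p $ a $ i * pd a (\<lambda>q. J q $ k $ j) p - J p $ a $ j * pd a (\<lambda>q. J q $ k $ i) p
     + J p $ k $ a * (pd j (\<lambda>q. J q $ a $ i) p - pd i (\<lambda>q. J q $ a $ j) p))"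

text \<open>The 2-form \<open>\<omega>(X, Y) = g(JX, Y)\<close>.\<close>

definition kahler_form ::
    "(real^'n::finite \<Rightarrow> real^'n^'n) \<Rightarrow> (real^'n \<Rightarrow> real^'n^'n) \<Rightarrow> real^'n \<Rightarrow> real^'n^'n" where
  "kahler_form g J p = transpose (J p) ** g p"

definition almost_hermitian_on ::
    "(real^'n::finite) set \<Rightarrow> (real^'n \<Rightarrow> real^'n^'n) \<Rightarrow> (real^'n \<Rightarrow> real^'n^'n) \<Rightarrow> bool" where
  "almost_hermitian_on S g J \<longleftrightarrow> riemannian_on S g \<and> smooth_on S J \<and>
     (\<forall>p\<in>S. (\<forall>X. J p *v (J p *v X) = - X) \<and>
            (\<forall>X Y. metric_ip g p (J p *v X) (J p *v Y) = metric_ip g p X Y))"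

definition hermitian_on ::
    "(real^'n::finite) set \<Rightarrow> (real^'n \<Rightarrow> real^'n^'n) \<Rightarrow> (real^'n \<Rightarrow> real^'n^'n) \<Rightarrow> bool" where
  "hermitian_on S g J \<longleftrightarrow> almost_hermitian_on S g J \<and> (\<forall>p\<in>S. \<forall>k i j. nijenhuis J k i j p = 0)"

definition kahler_on ::
    "(real^'n::finite) set \<Rightarrow> (real^'n \<Rightarrow> real^'n^'n) \<Rightarrow> (real^'n \<Rightarrow> real^'n^'n) \<Rightarrow> bool" where
  "kahler_on S g J \<longleftrightarrow> hermitian_on S g J \<and>
     (\<forall>p\<in>S. \<forall>i j k. ext_d2 (kahler_form g J) i j k p = 0)"

definition lck_on ::
    "(real^'n::finite) set \<Rightarrow> (real^'n \<Rightarrow> real^'n^'n) \<Rightarrow> (real^'n \<Rightarrow> real^'n^'n) \<Rightarrow> bool" where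
  "lck_on S g I \<longleftrightarrow> hermitian_on S g I \<and>
     (\<forall>p\<in>S. \<exists>V f. open V \<and> p \<in> V \<and> V \<subseteq> S \<and> smooth_on V f \<and> (\<forall>q\<in>V. f q > 0) \<and>
        kahler_on V (\<lambda>q. f q *\<^sub>R g q) I)"

definition lee_form_on ::
    "(real^'n::finite) set \<Rightarrow> (real^'n \<Rightarrow> real^'n^'n) \<Rightarrow> (real^'n \<Rightarrow> real^'n^'n) \<Rightarrow>
     (real^'n \<Rightarrow> real^'n) \<Rightarrow> bool" where
  "lee_form_on S g I \<theta> \<longleftrightarrow> smooth_on S \<theta> \<and>
     (\<forall>p\<in>S. \<forall>i j k. ext_d2 (kahler_form g I) i j k p = 2 * wedge12 \<theta> (kahler_form g I) i j k p)"

section \<open>QCH Kaehler surfaces\<close>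

definition distribution2_on :: "(real^4) set \<Rightarrow> (real^4 \<Rightarrow> (real^4) set) \<Rightarrow> bool" where
  "distribution2_on S D \<longleftrightarrow> (\<forall>p\<in>S. subspace (D p) \<and> dim (D p) = 2) \<and>
     (\<forall>p\<in>S. \<exists>V X Y. open V \<and> p \<in> V \<and> V \<subseteq> S \<and> smooth_on V X \<and> smooth_on V Y \<and>
        (\<forall>q\<in>V. D q = span {X q, Y q}))"

definition perp ::
    "(real^4 \<Rightarrow> real^4^4) \<Rightarrow> (real^4 \<Rightarrow> (real^4) set) \<Rightarrow> real^4 \<Rightarrow> (real^4) set" where
  "perp g D p = {X. \<forall>Y\<in>D p. metric_ip g p X Y = 0}"

definition orth_proj ::
    "(real^4 \<Rightarrow> real^4^4) \<Rightarrow> (real^4 \<Rightarrow> (real^4) set) \<Rightarrow> real^4 \<Rightarrow> real^4 \<Rightarrow> real^4" where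
  "orth_proj g D p X = (THE Y. Y \<in> D p \<and> X - Y \<in> perp g D p)"

text \<open>Holomorphic curvature of the \<open>J\<close>-invariant plane through the unit vector \<open>X\<close>; the
  \<open>J\<close>-invariant 2-planes containing \<open>X\<close> are exactly \<open>span {X, J X}\<close>.\<close>

definition hol_curv ::
    "(real^4 \<Rightarrow> real^4^4) \<Rightarrow> (real^4 \<Rightarrow> real^4^4) \<Rightarrow> real^4 \<Rightarrow> real^4 \<Rightarrow> real" where
  "hol_curv g J p X = riem g p X (J p *v X) (J p *v X) X"

definition qch_kahler_on ::
    "(real^4) set \<Rightarrow> (real^4 \<Rightarrow> real^4^4) \<Rightarrow> (real^4 \<Rightarrow> real^4^4) \<Rightarrow>
     (real^4 \<Rightarrow> (real^4) set) \<Rightarrow> bool" where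
  "qch_kahler_on S g J D \<longleftrightarrow> kahler_on S g J \<and> distribution2_on S D \<and>
     (\<forall>p\<in>S. \<forall>X\<in>D p. J p *v X \<in> D p) \<and>
     (\<exists>\<phi>. \<forall>p\<in>S. \<forall>X. metric_ip g p X X = 1 \<longrightarrow>
        hol_curv g J p X = \<phi> p (metric_norm g p (orth_proj g D p X)))"

definition opposite_on ::
    "(real^4) set \<Rightarrow> (real^4 \<Rightarrow> real^4^4) \<Rightarrow> (real^4 \<Rightarrow> real^4^4) \<Rightarrow>
     (real^4 \<Rightarrow> (real^4) set) \<Rightarrow> (real^4 \<Rightarrow> real^4^4) \<Rightarrow> bool" where
  "opposite_on S g J D I \<longleftrightarrow>
     (\<forall>p\<in>S. (\<forall>X\<in>D p. I p *v X = J p *v X) \<and> (\<forall>X\<in>perp g D p. I p *v X = - (J p *v X)))"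

definition nullity ::
    "(real^4 \<Rightarrow> real^4^4) \<Rightarrow> (real^4 \<Rightarrow> real^4^4) \<Rightarrow> real^4 \<Rightarrow> (real^4) set" where
  "nullity g I p = {X. cov_endo g I p X = 0}"

text \<open>Generalized Calabi type requires both descriptions of the distinguished distribution:
  it is spanned by the Lee field and its \<open>I\<close>-image, and it is the nullity of \<open>\<nabla>I\<close>.\<close>

definition generalized_calabi_on ::
    "(real^4) set \<Rightarrow> (real^4 \<Rightarrow> real^4^4) \<Rightarrow> (real^4 \<Rightarrow> real^4^4) \<Rightarrow>
     (real^4 \<Rightarrow> (real^4) set) \<Rightarrow> (real^4 \<Rightarrow> real^4^4) \<Rightarrow> bool" where
  "generalized_calabi_on S g J D I \<longleftrightarrow>
     qch_kahler_on S g J D \<and> opposite_on S g J D I \<and> hermitian_on S g I \<and>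
     (\<forall>p\<in>S. cov_endo_norm g I p > 0) \<and>
     (\<exists>\<theta>. lee_form_on S g I \<theta> \<and>
        (\<forall>p\<in>S. span {sharp g \<theta> p, I p *v sharp g \<theta> p} = nullity g I p) \<and>
        ((\<forall>p\<in>S. D p = span {sharp g \<theta> p, I p *v sharp g \<theta> p}) \<or>
         (\<forall>p\<in>S. perp g D p = span {sharp g \<theta> p, I p *v sharp g \<theta> p})))"

definition calabi_on ::
    "(real^4) set \<Rightarrow> (real^4 \<Rightarrow> real^4^4) \<Rightarrow> (real^4 \<Rightarrow> real^4^4) \<Rightarrow>
     (real^4 \<Rightarrow> (real^4) set) \<Rightarrow> bool" where
  "calabi_on S g J D \<longleftrightarrow> (\<exists>I. generalized_calabi_on S g J D I \<and> lck_on S g I)"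

text \<open>The structure on the dense open set is the restriction of the whole QCH structure, so the same
  \<open>D\<close>, and with it the same \<open>I\<close>, is used there.\<close>

definition qch_kahler_calabi_type_on ::
    "(real^4) set \<Rightarrow> (real^4 \<Rightarrow> real^4^4) \<Rightarrow> (real^4 \<Rightarrow> real^4^4) \<Rightarrow> bool" where
  "qch_kahler_calabi_type_on N g J \<longleftrightarrow>
     (\<exists>D. qch_kahler_on N g J D \<and>
        (\<exists>U. open U \<and> U \<subseteq> N \<and> N \<subseteq> closure U \<and> calabi_on U g J D))"

section \<open>The exceptional half plane instanton\<close>

lemma vector_4 [simp]:
  "(vector [a, b, c, d] :: 'a::zero^4) $ 1 = a"
  "(vector [a, b, c, d] :: 'a::zero^4) $ 2 = b"
  "(vector [a, b, c, d] :: 'a::zero^4) $ 3 = c"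
  "(vector [a, b, c, d] :: 'a::zero^4) $ 4 = d"
  unfolding vector_def by simp_all

text \<open>Adapted coordinates are \<open>q = (x, y, \<theta>\<^sub>1, \<theta>\<^sub>2)\<close> with \<open>x > 0\<close> and \<open>\<theta>\<^sub>1\<close> lifted to the reals.
  The Cartesian coordinates are \<open>(x\<^sub>1, y\<^sub>1, x\<^sub>2, y\<^sub>2)\<close>.\<close>

definition adapted_domain :: "(real^4) set" where
  "adapted_domain = {q. q $ 1 > 0}"

definition cart :: "real^4 \<Rightarrow> real^4" where
  "cart q = vector [q $ 1 * cos (q $ 3), q $ 1 * sin (q $ 3), q $ 2, q $ 4]"

definition adapted_metric :: "real^4 \<Rightarrow> real^4^4" where
  "adapted_metric q = (let x = q $ 1; y = q $ 2; G11 = x^2 / (1 + x^2);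
       G12 = 2 * x^2 * y / (1 + x^2); G22 = ((1 + x^2)^2 + 4 * x^2 * y^2) / (1 + x^2) in
     vector [vector [1 + x^2, 0, 0, 0],
             vector [0, 1 + x^2, 0, 0],
             vector [0, 0, G11, G12],
             vector [0, 0, G12, G22]])"

text \<open>Here \<open>(\<alpha> \<and> \<beta>)(X, Y) = \<alpha>(X)\<beta>(Y) - \<alpha>(Y)\<beta>(X)\<close>.\<close>

definition adapted_form :: "real^4 \<Rightarrow> real^4^4" where
  "adapted_form q = (let x = q $ 1; y = q $ 2 in
     vector [vector [0, 0, x, 2 * x * y],
             vector [0, 0, 0, 1 + x^2],
             vector [- x, 0, 0, 0],
             vector [- (2 * x * y), - (1 + x^2), 0, 0]])"

text \<open>A smooth pair \<open>(g, J)\<close> on all of \<open>real^4\<close> extending the structure given in adapted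
  coordinates. Such a pair is unique because \<open>cart\<close> maps the adapted domain onto the
  dense set \<open>(x\<^sub>1, y\<^sub>1) \<noteq> 0\<close>.\<close>

definition exceptional_half_plane_instanton ::
    "(real^4 \<Rightarrow> real^4^4) \<Rightarrow> (real^4 \<Rightarrow> real^4^4) \<Rightarrow> bool" where
  "exceptional_half_plane_instanton g J \<longleftrightarrow> smooth_on UNIV g \<and> smooth_on UNIV J \<and>
     (\<forall>q\<in>adapted_domain. pullback cart g q = adapted_metric q \<and>
        pullback cart (kahler_form g J) q = adapted_form q)"

end

theory Submission
  imports Defs
begin

text \<open>
  Write \<open>(u, v, y, t)\<close> for the Cartesian coordinates, \<open>z = u + iv\<close> and \<open>\<sigma> = 1 + |z|\<^sup>2\<close>. In the adapted
  coordinates the metric is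
  \<open>\<sigma> (dx\<^sup>2 + dy\<^sup>2) + (x\<^sup>2 / \<sigma>) (d\<theta>\<^sub>1 + 2y dt)\<^sup>2 + \<sigma> dt\<^sup>2\<close>,
  so the \<open>z\<close>-plane is a fibre over the \<open>(y, t)\<close>-plane, and \<open>2y dt\<close> is the connection of the fibration.
  On a fibre \<open>z exp(|z|\<^sup>2 / 2)\<close> is a holomorphic coordinate; \<open>exp(- |z|\<^sup>2 / 2)\<close> times its differential,
  with \<open>d\<theta>\<^sub>1\<close> replaced by \<open>d\<theta>\<^sub>1 + 2y dt\<close>, is \<open>\<alpha> = dz + z (d\<sigma> / 2 + 2iy dt)\<close>. With
  \<open>\<beta> = dy + i dt\<close> and \<open>\<theta> = \<alpha> / \<sigma>\<close> the metric becomes \<open>\<sigma> (|\<theta>|\<^sup>2 + |\<beta>|\<^sup>2)\<close>. This is smooth on all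
  of \<open>real^4\<close>: the coframe \<open>(Re \<theta>, Im \<theta>, Re \<beta>, Im \<beta>)\<close> is dual to a frame with polynomial
  components. It agrees with the given data on the adapted domain (\<open>pullback_metric\<close>,
  \<open>pullback_form\<close>), and it is the only continuous extension, because \<open>cart\<close> is a local
  diffeomorphism onto the dense set \<open>z \<noteq> 0\<close> (\<open>instanton_unique\<close>).

  In that frame everything of interest is constant or nearly so. The complex structure \<open>J\<close> is
  multiplication by \<open>i\<close> on both factors \<open>\<complex>\<close>; the distribution \<open>D\<close> is the fibre direction
  \<open>\<beta> = 0\<close>; the opposite structure \<open>I\<close> is \<open>i\<close> on the first factor and \<open>-i\<close> on the second. The
  Levi-Civita connection is \<open>d\<sigma> / (2\<sigma>) + \<psi>\<close> with a \<open>u(2)\<close>-valued 1-form \<open>\<psi>\<close>, and most of what is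
  to be shown is matrix algebra with \<open>\<psi>\<close>.

  First, \<open>\<psi>\<close> commutes with \<open>J\<close>, so \<open>J\<close> is parallel, in particular integrable; in coordinates
  \<open>\<omega>\<^sub>J = du \<and> dv + \<sigma> dy \<and> dt + y d\<sigma> \<and> dt\<close>, which is closed (\<open>kahler_J\<close>).

  Second, the only entry of \<open>\<psi>\<close> that does not commute with \<open>I\<close> is
  \<open>\<psi>\<^sub>1\<^sub>2 = - (z / \<sigma>) (dy - i dt)\<close>. Hence, where \<open>z \<noteq> 0\<close>, \<open>\<nabla>\<^sub>X I\<close> vanishes exactly for
  \<open>X \<in> D\<close> (\<open>nullity_I\<close>), and \<open>\<nabla>\<^sub>I\<^sub>X I = I \<nabla>\<^sub>X I\<close>, which makes \<open>I\<close> integrable (\<open>hermitian_I\<close>).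
  Moreover \<open>d\<omega>\<^sub>I = 2 d(log \<sigma>) \<and> \<omega>\<^sub>I\<close>, so \<open>d(log \<sigma>)\<close> is the Lee form, its dual field spans \<open>D\<close>
  together with its \<open>I\<close>-image where \<open>z \<noteq> 0\<close>, and \<open>g / \<sigma>\<^sup>2\<close> is Kaehler (\<open>generalized_calabi\<close>, \<open>lck_I\<close>).

  Third, the components of the curvature \<open>d\<psi> + \<psi> \<and> \<psi>\<close> in the frame are functions of \<open>\<sigma>\<close>
  (\<open>curvature_form_eq\<close>). The holomorphic curvature of a unit vector \<open>X\<close> is therefore a quadratic
  polynomial in \<open>|\<theta>(X)|\<^sup>2\<close> and \<open>|\<beta>(X)|\<^sup>2\<close> with coefficients depending on the point, and these two
  numbers are determined by \<open>|X\<^sub>D|\<close> (\<open>hol_curv_frame\<close>, \<open>qch_kahler\<close>).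
\<close>

section \<open>Partial derivatives and smoothness\<close>

lemma pd_eqI: "(f has_derivative f') (at p) \<Longrightarrow> pd i f p = f' (axis i 1)"
  unfolding pd_def using frechet_derivative_at by metis

lemma pd_cong_open:
  assumes "open S" "p \<in> S" "\<And>q. q \<in> S \<Longrightarrow> f q = h q" "f differentiable (at p)"
  shows "pd i f p = pd i h p"
  unfolding pd_def using frechet_derivative_transform_within_open[OF assms(4,1,2)] assms(3) by metis

lemma differentiable_cong_open:
  assumes "open S" "p \<in> S" "\<And>q. q \<in> S \<Longrightarrow> f q = h q" "f differentiable (at p)"
  shows "h differentiable (at p)"
  using assms has_derivative_transform_within_open unfolding differentiable_def by blast

lemma pd_const [simp]: "pd i (\<lambda>q. c) p = 0"
  by (simp add: pd_def)

lemma pd_bounded_linear: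
  assumes "bounded_linear L" "f differentiable (at p)"
  shows "pd i (\<lambda>q. L (f q)) p = L (pd i f p)"
  using pd_eqI[OF bounded_linear.has_derivative[OF assms(1) assms(2)[unfolded frechet_derivative_works]]]
  by (simp add: pd_def)

lemma differentiable_bounded_linear:
  assumes "bounded_linear L" "f differentiable (at p)"
  shows "(\<lambda>q. L (f q)) differentiable (at p)"
  using bounded_linear.has_derivative[OF assms(1)] assms(2) unfolding differentiable_def by blast

lemma pd_bounded_bilinear:
  assumes "bounded_bilinear B" "f differentiable (at p)" "h differentiable (at p)"
  shows "pd i (\<lambda>q. B (f q) (h q)) p = B (f p) (pd i h p) + B (pd i f p) (h p)"
  using pd_eqI[OF bounded_bilinear.FDERIV[OF assms(1) assms(2,3)[unfolded frechet_derivative_works]]]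
  by (simp add: pd_def)

lemma differentiable_bounded_bilinear:
  assumes "bounded_bilinear B" "f differentiable (at p)" "h differentiable (at p)"
  shows "(\<lambda>q. B (f q) (h q)) differentiable (at p)"
  using bounded_bilinear.FDERIV[OF assms(1)] assms(2,3) unfolding differentiable_def by blast

lemma pd_add [simp]:
  assumes "f differentiable (at p)" "h differentiable (at p)"
  shows "pd i (\<lambda>q. f q + h q) p = pd i f p + pd i h p"
  using pd_eqI[OF has_derivative_add[OF assms[unfolded frechet_derivative_works]]] by (simp add: pd_def)

lemma pd_diff [simp]:
  assumes "f differentiable (at p)" "h differentiable (at p)"
  shows "pd i (\<lambda>q. f q - h q) p = pd i f p - pd i h p"
  using pd_eqI[OF has_derivative_diff[OF assms[unfolded frechet_derivative_works]]] by (simp add: pd_def)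

lemma pd_minus [simp]:
  assumes "f differentiable (at p)"
  shows "pd i (\<lambda>q. - f q) p = - pd i f p"
  using pd_eqI[OF has_derivative_minus[OF assms[unfolded frechet_derivative_works]]] by (simp add: pd_def)

lemma pd_mult [simp]:
  fixes f h :: "real^'n::finite \<Rightarrow> real"
  assumes "f differentiable (at p)" "h differentiable (at p)"
  shows "pd i (\<lambda>q. f q * h q) p = f p * pd i h p + pd i f p * h p"
  using pd_bounded_bilinear[OF bounded_bilinear_mult assms] .

lemma pd_inverse:
  fixes f :: "real^'n::finite \<Rightarrow> real"
  assumes "f differentiable (at p)" "f p \<noteq> 0"
  shows "pd i (\<lambda>q. inverse (f q)) p = - (pd i f p * (inverse (f p) * inverse (f p)))"
  using pd_eqI[OF Deriv.has_derivative_inverse[OF assms(2) assms(1)[unfolded frechet_derivative_works]], of i]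
  by (simp add: pd_def mult.assoc mult.left_commute)

lemma pd_divide [simp]:
  fixes f :: "real^'n::finite \<Rightarrow> real"
  assumes "f differentiable (at p)" "h differentiable (at p)" "h p \<noteq> 0"
  shows "pd i (\<lambda>q. f q / h q) p = (pd i f p * h p - f p * pd i h p) / (h p)^2"
proof -
  have "(\<lambda>q. inverse (h q)) differentiable (at p)"
    using assms by (simp add: differentiable_inverse)
  then have "pd i (\<lambda>q. f q * inverse (h q)) p =
      f p * - (pd i h p * (inverse (h p) * inverse (h p))) + pd i f p * inverse (h p)"
    using assms by (simp add: pd_inverse)
  then show ?thesis using assms(3) by (simp add: field_simps power2_eq_square)
qed

lemma pd_power2 [simp]:
  fixes f :: "real^'n::finite \<Rightarrow> real"
  assumes "f differentiable (at p)"
  shows "pd i (\<lambda>q. (f q)\<^sup>2) p = 2 * f p * pd i f p"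
  using assms by (simp add: power2_eq_square)

lemma pd_nth:
  "f differentiable (at p) \<Longrightarrow> pd i (\<lambda>q. f q $ a) p = pd i f p $ a"
  using pd_bounded_linear[OF bounded_linear_vec_nth] by blast

lemma differentiable_nth [simp]:
  "f differentiable (at p) \<Longrightarrow> (\<lambda>q. f q $ a) differentiable (at p)"
  using differentiable_bounded_linear[OF bounded_linear_vec_nth] by blast

lemma pd_ident [simp]: "pd i (\<lambda>q. q) p = axis i 1"
  by (simp add: pd_def)

lemma pd_coord [simp]: "pd i (\<lambda>q. q $ a) p = (if a = i then 1 else 0)"
  using pd_nth[of "\<lambda>q. q" p i a] by (simp add: axis_def)

lemma pd_entry:
  fixes M :: "real^'n::finite \<Rightarrow> 'b::real_normed_vector^'k^'m"
  assumes "M differentiable (at p)"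
  shows "pd i M p $ a $ b = pd i (\<lambda>q. M q $ a $ b) p"
  using assms by (simp add: pd_nth)

lemma bounded_bilinear_matrix_mult:
  "bounded_bilinear ((**) :: real^'n^'m \<Rightarrow> real^'k^'n \<Rightarrow> real^'k^'m)"
  unfolding bilinear_conv_bounded_bilinear[symmetric] bilinear_def
  by (auto intro!: linearI simp: vec_eq_iff matrix_matrix_mult_def algebra_simps
      sum.distrib sum_distrib_left)

lemma pd_matrix_mult:
  assumes "f differentiable (at p)" "h differentiable (at p)"
  shows "pd i (\<lambda>q. f q ** h q :: real^'k^'m) p = f p ** pd i h p + pd i f p ** h p"
  using pd_bounded_bilinear[OF bounded_bilinear_matrix_mult assms] .

lemma differentiable_matrix_mult:
  assumes "f differentiable (at p)" "h differentiable (at p)"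
  shows "(\<lambda>q. f q ** h q :: real^'k^'m) differentiable (at p)"
  using differentiable_bounded_bilinear[OF bounded_bilinear_matrix_mult assms] .

text \<open>
  The recursion in the definition of \<open>Ck_on\<close> differentiates a function everywhere, while the rules
  of calculus give its derivative only on \<open>S\<close>. Openness of \<open>S\<close> bridges this: derivatives at points
  of \<open>S\<close> see only the values on \<open>S\<close>.
\<close>

lemma Ck_on_cong:
  assumes "open S" "\<And>q. q \<in> S \<Longrightarrow> f q = h q" "Ck_on k S f"
  shows "Ck_on k S h"
  using assms(2,3)
proof (induction k arbitrary: f h)
  case 0
  then show ?case using continuous_on_cong by fastforce
next
  case (Suc k)
  have "pd i f q = pd i h q" if "q \<in> S" for i q
    by (rule pd_cong_open[OF assms(1) that]) (use Suc.prems that in auto)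
  then have "Ck_on k S (pd i h)" for i
    using Suc.IH[of "pd i f" "pd i h"] Suc.prems by auto
  then show ?case
    using Suc.prems differentiable_cong_open[OF assms(1), of _ f h] by auto
qed

lemma Ck_on_Suc_imp: "Ck_on (Suc k) S f \<Longrightarrow> Ck_on k S f"
proof (induction k arbitrary: f)
  case 0
  then show ?case
    by (auto intro!: differentiable_imp_continuous_on differentiable_at_imp_differentiable_on)
qed auto

lemma Ck_on_const: "Ck_on k S (\<lambda>q. c)"
proof (induction k arbitrary: c)
  case (Suc k)
  have "pd i (\<lambda>q. c) = (\<lambda>q. 0)" for i :: 'a and c :: 'b
    by (rule ext) simp
  with Suc show ?case by simp
qed simp

lemma Ck_on_bounded_linear:
  assumes S: "open S" and L: "bounded_linear L" and "Ck_on k S f"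
  shows "Ck_on k S (\<lambda>q. L (f q))"
  using assms(3)
proof (induction k arbitrary: f)
  case 0
  then show ?case using bounded_linear.continuous_on[OF L] by auto
next
  case (Suc k)
  have "Ck_on k S (pd i (\<lambda>q. L (f q)))" for i
    by (rule Ck_on_cong[OF S _ Suc.IH[of "pd i f"]])
      (use Suc.prems pd_bounded_linear[OF L, of f] in auto)
  then show ?case using Suc.prems differentiable_bounded_linear[OF L] by auto
qed

lemma Ck_on_add:
  assumes S: "open S" and "Ck_on k S f" "Ck_on k S h"
  shows "Ck_on k S (\<lambda>q. f q + h q)"
  using assms(2,3)
proof (induction k arbitrary: f h)
  case 0
  then show ?case by (auto intro: continuous_on_add)
next
  case (Suc k)
  have "Ck_on k S (pd i (\<lambda>q. f q + h q))" for i
    by (rule Ck_on_cong[OF S _ Suc.IH[of "pd i f" "pd i h"]]) (use Suc.prems in auto)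
  then show ?case using Suc.prems by auto
qed

text \<open>
  By the Leibniz rule the derivative of a product pairs a derivative of one factor with the other
  factor itself, so the induction uses each factor at the lower order as well.
\<close>

lemma Ck_on_bounded_bilinear:
  assumes S: "open S" and B: "bounded_bilinear B" and "Ck_on k S f" "Ck_on k S h"
  shows "Ck_on k S (\<lambda>q. B (f q) (h q))"
  using assms(3,4)
proof (induction k arbitrary: f h)
  case 0
  then show ?case using bounded_bilinear.continuous_on[OF B] by auto
next
  case (Suc k)
  note low = Suc.prems[THEN Ck_on_Suc_imp]
  have "Ck_on k S (pd i (\<lambda>q. B (f q) (h q)))" for i
  proof (rule Ck_on_cong[OF S])
    show "Ck_on k S (\<lambda>q. B (f q) (pd i h q) + B (pd i f q) (h q))"
      using Suc low by (intro Ck_on_add[OF S]) auto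
  qed (use Suc.prems pd_bounded_bilinear[OF B, of f _ h] in auto)
  then show ?case using Suc.prems by (auto intro: differentiable_bounded_bilinear[OF B])
qed

lemma Ck_on_inverse:
  fixes f :: "real^'n::finite \<Rightarrow> real"
  assumes S: "open S" and nz: "\<And>q. q \<in> S \<Longrightarrow> f q \<noteq> 0" and "Ck_on k S f"
  shows "Ck_on k S (\<lambda>q. inverse (f q))"
  using assms(3)
proof (induction k)
  case 0
  then show ?case using nz by (auto intro: continuous_on_inverse)
next
  case (Suc k)
  have inv: "Ck_on k S (\<lambda>q. inverse (f q))"
    using Suc.IH Ck_on_Suc_imp[OF Suc.prems] .
  have "Ck_on k S (pd i (\<lambda>q. inverse (f q)))" for i
  proof (rule Ck_on_cong[OF S])
    show "Ck_on k S (\<lambda>q. - (pd i f q * (inverse (f q) * inverse (f q))))"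
      using Suc.prems inv
      by (intro Ck_on_bounded_linear[OF S bounded_linear_minus[OF bounded_linear_ident]]
          Ck_on_bounded_bilinear[OF S bounded_bilinear_mult]) auto
  qed (use Suc.prems pd_inverse[of f] nz in auto)
  then show ?case using Suc.prems nz by (auto intro: differentiable_inverse)
qed

lemma smooth_on_differentiable: "smooth_on S f \<Longrightarrow> p \<in> S \<Longrightarrow> f differentiable (at p)"
  unfolding smooth_on_def by (metis Ck_on.simps(2))

lemma smooth_on_pd: "smooth_on S f \<Longrightarrow> smooth_on S (pd i f)"
  unfolding smooth_on_def by (metis Ck_on.simps(2))

lemma smooth_on_const: "smooth_on S (\<lambda>q. c)"
  by (simp add: smooth_on_def Ck_on_const)

lemma smooth_on_add:
  "open S \<Longrightarrow> smooth_on S f \<Longrightarrow> smooth_on S h \<Longrightarrow> smooth_on S (\<lambda>q. f q + h q)"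
  by (simp add: smooth_on_def Ck_on_add)

lemma smooth_on_bounded_linear:
  "open S \<Longrightarrow> bounded_linear L \<Longrightarrow> smooth_on S f \<Longrightarrow> smooth_on S (\<lambda>q. L (f q))"
  by (simp add: smooth_on_def Ck_on_bounded_linear)

lemma smooth_on_bounded_bilinear:
  "open S \<Longrightarrow> bounded_bilinear B \<Longrightarrow> smooth_on S f \<Longrightarrow> smooth_on S h \<Longrightarrow>
    smooth_on S (\<lambda>q. B (f q) (h q))"
  by (simp add: smooth_on_def Ck_on_bounded_bilinear)

lemma smooth_on_minus:
  "open S \<Longrightarrow> smooth_on S f \<Longrightarrow> smooth_on S (\<lambda>q. - f q)"
  by (rule smooth_on_bounded_linear[OF _ bounded_linear_minus[OF bounded_linear_ident]])

lemma smooth_on_diff: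
  "open S \<Longrightarrow> smooth_on S f \<Longrightarrow> smooth_on S h \<Longrightarrow> smooth_on S (\<lambda>q. f q - h q)"
  using smooth_on_add[of S f "\<lambda>q. - h q"] smooth_on_minus[of S h] by simp

lemma smooth_on_mult:
  fixes f :: "real^'n::finite \<Rightarrow> real"
  shows "open S \<Longrightarrow> smooth_on S f \<Longrightarrow> smooth_on S h \<Longrightarrow> smooth_on S (\<lambda>q. f q * h q)"
  by (rule smooth_on_bounded_bilinear[OF _ bounded_bilinear_mult])

lemma smooth_on_power2:
  fixes f :: "real^'n::finite \<Rightarrow> real"
  shows "open S \<Longrightarrow> smooth_on S f \<Longrightarrow> smooth_on S (\<lambda>q. (f q)\<^sup>2)"
  unfolding power2_eq_square by (intro smooth_on_mult)

lemma smooth_on_divide: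
  fixes f :: "real^'n::finite \<Rightarrow> real"
  assumes "open S" "smooth_on S f" "smooth_on S h" "\<And>q. q \<in> S \<Longrightarrow> h q \<noteq> 0"
  shows "smooth_on S (\<lambda>q. f q / h q)"
  unfolding divide_inverse
  using assms by (intro smooth_on_mult) (auto simp: smooth_on_def Ck_on_inverse)

lemma smooth_on_nth: "open S \<Longrightarrow> smooth_on S (\<lambda>q. q $ a)"
  unfolding smooth_on_def
proof
  fix k
  assume S: "open S"
  have d: "pd i (\<lambda>q::real^'a. q) = (\<lambda>q. axis i 1)" for i by (rule ext) simp
  then have "Ck_on k S (\<lambda>q::real^'a. q)"
    by (cases k) (auto simp: Ck_on_const continuous_on_id d)
  then show "Ck_on k S (\<lambda>q. q $ a)"
    using Ck_on_bounded_linear[OF S bounded_linear_vec_nth] by fastforce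
qed

lemma smooth_on_sum:
  "open S \<Longrightarrow> (\<And>a. a \<in> A \<Longrightarrow> smooth_on S (f a)) \<Longrightarrow> smooth_on S (\<lambda>q. \<Sum>a\<in>A. f a q)"
  by (induction A rule: infinite_finite_induct) (auto intro: smooth_on_const smooth_on_add)

text \<open>Smoothness of matrix fields is reduced to that of the entries, through the expansion in the
  standard basis.\<close>

lemma smooth_on_vec:
  fixes X :: "real^'n::finite \<Rightarrow> 'b::real_normed_vector^'m::finite"
  assumes "open S" "\<And>a. smooth_on S (\<lambda>q. X q $ a)"
  shows "smooth_on S X"
proof -
  have norm_axis: "norm (axis a x :: 'b^'m) = norm x" for a x
  proof -
    have "(\<Sum>i\<in>UNIV. (norm ((axis a x :: 'b^'m) $ i))\<^sup>2) = (\<Sum>i\<in>UNIV. if i = a then (norm x)\<^sup>2 else 0)"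
      by (rule sum.cong) (auto simp: axis_def)
    then show ?thesis by (simp add: norm_vec_def L2_set_def)
  qed
  have lin: "bounded_linear (axis a :: 'b \<Rightarrow> 'b^'m)" for a
    by (rule bounded_linear_intro[where K = 1]) (auto simp: vec_eq_iff norm_axis, auto simp: axis_def)
  have "smooth_on S (\<lambda>q. \<Sum>a\<in>UNIV. axis a (X q $ a))"
    using assms smooth_on_bounded_linear[OF assms(1) lin] by (intro smooth_on_sum) auto
  moreover have "(\<Sum>a\<in>UNIV. axis a (X q $ a)) = X q" for q
    by (simp add: vec_eq_iff axis_def if_distrib cong: if_cong)
  ultimately show ?thesis by simp
qed

lemma smooth_on_matrix_mult:
  "open S \<Longrightarrow> smooth_on S f \<Longrightarrow> smooth_on S h \<Longrightarrow> smooth_on S (\<lambda>q. f q ** h q :: real^'k^'m)"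
  by (rule smooth_on_bounded_bilinear[OF _ bounded_bilinear_matrix_mult])

section \<open>The Levi-Civita connection in a moving frame\<close>

lemmas matrix_mult_bilinear =
  bounded_bilinear.add_left[OF bounded_bilinear_matrix_mult]
  bounded_bilinear.add_right[OF bounded_bilinear_matrix_mult]
  bounded_bilinear.diff_left[OF bounded_bilinear_matrix_mult]
  bounded_bilinear.diff_right[OF bounded_bilinear_matrix_mult]
  bounded_bilinear.minus_left[OF bounded_bilinear_matrix_mult]
  bounded_bilinear.minus_right[OF bounded_bilinear_matrix_mult]
  bounded_bilinear.scaleR_left[OF bounded_bilinear_matrix_mult]
  bounded_bilinear.scaleR_right[OF bounded_bilinear_matrix_mult]
  bounded_bilinear.sum_left[OF bounded_bilinear_matrix_mult]
  bounded_bilinear.sum_right[OF bounded_bilinear_matrix_mult]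

lemma matrix_inv_eqI:
  fixes A B :: "real^'n^'n"
  assumes "A ** B = mat 1"
  shows "matrix_inv A = B"
proof -
  have BA: "B ** A = mat 1"
    using assms matrix_left_right_inverse by blast
  have "invertible A"
    using assms BA unfolding invertible_def by blast
  then have inv: "A ** matrix_inv A = mat 1"
    unfolding invertible_def matrix_inv_def by (rule someI2_ex) simp
  have "matrix_inv A = (B ** A) ** matrix_inv A"
    by (simp add: BA)
  also have "\<dots> = B"
    by (simp add: matrix_mul_assoc[symmetric] inv)
  finally show ?thesis .
qed

lemma bounded_linear_transpose: "bounded_linear (transpose :: real^'n^'m \<Rightarrow> _)"
  by (simp add: linear_conv_bounded_linear[symmetric] linear_iff transpose_def vec_eq_iff)

lemma matrix_vector_sum_left:
  fixes M :: "'a \<Rightarrow> real^'n^'m"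
  shows "(\<Sum>a\<in>I. M a) *v x = (\<Sum>a\<in>I. M a *v x)"
  by (induction I rule: infinite_finite_induct) (auto simp: matrix_vector_mult_add_rdistrib)

text \<open>
  Cartan's method for a metric \<open>f (\<theta>\<^sup>1 \<otimes> \<theta>\<^sup>1 + \<dots> + \<theta>\<^sup>n \<otimes> \<theta>\<^sup>n)\<close> that is conformal to one with an
  explicit orthonormal coframe. The rows of \<open>E\<close> are the coframe, the columns of \<open>F\<close> the dual frame,
  and \<open>A i\<close> is the candidate for the matrix of \<open>\<nabla>\<^sub>i\<close> in the frame. The two conditions that identify
  the Levi-Civita connection are \<open>metric_connection\<close>, which says that \<open>A - d(log f) / 2\<close> is skew, and
  \<open>torsion_free\<close>, the first structure equation \<open>dE + A \<and> E = 0\<close>. Keeping the factor \<open>f\<close>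
  apart from the coframe avoids square roots of \<open>f\<close> in concrete calculations.
\<close>

locale moving_frame =
  fixes S :: "(real^'n::finite) set"
    and E F :: "real^'n \<Rightarrow> real^'n^'n"
    and A :: "'n \<Rightarrow> real^'n \<Rightarrow> real^'n^'n"
    and f :: "real^'n \<Rightarrow> real"
    and g :: "real^'n \<Rightarrow> real^'n^'n"
  assumes open_S: "open S"
    and metric: "\<And>p. p \<in> S \<Longrightarrow> g p = f p *\<^sub>R (transpose (E p) ** E p)"
    and factor_nonzero: "\<And>p. p \<in> S \<Longrightarrow> f p \<noteq> 0"
    and coframe_frame: "\<And>p. p \<in> S \<Longrightarrow> E p ** F p = mat 1"
    and differentiable_E: "\<And>p. p \<in> S \<Longrightarrow> E differentiable (at p)"
    and differentiable_F: "\<And>p. p \<in> S \<Longrightarrow> F differentiable (at p)"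
    and differentiable_pd_F: "\<And>p i. p \<in> S \<Longrightarrow> pd i F differentiable (at p)"
    and differentiable_A: "\<And>p i. p \<in> S \<Longrightarrow> A i differentiable (at p)"
    and differentiable_f: "\<And>p. p \<in> S \<Longrightarrow> f differentiable (at p)"
    and mixed_pd_F: "\<And>p i j. p \<in> S \<Longrightarrow> pd i (pd j F) p = pd j (pd i F) p"
    and metric_connection:
      "\<And>p i. p \<in> S \<Longrightarrow> A i p + transpose (A i p) = mat (pd i f p / f p)"
    and torsion_free: "\<And>p i j a. p \<in> S \<Longrightarrow>
      pd i E p $ a $ j + (A i p ** E p) $ a $ j = pd j E p $ a $ i + (A j p ** E p) $ a $ i"
begin

text \<open>The matrix of \<open>\<nabla>\<^sub>i\<close> in the standard coordinates, obtained from \<open>\<nabla>\<^sub>i F = F A\<^sub>i\<close>.\<close>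

definition connection_matrix :: "'n \<Rightarrow> real^'n \<Rightarrow> real^'n^'n" where
  "connection_matrix i p = (F p ** A i p - pd i F p) ** E p"

lemma frame_coframe: "p \<in> S \<Longrightarrow> F p ** E p = mat 1"
  using coframe_frame matrix_left_right_inverse by blast

lemma pd_E:
  assumes "p \<in> S"
  shows "E p ** pd i F p + pd i E p ** F p = 0"
proof -
  have "pd i (\<lambda>q. E q ** F q) p = pd i (\<lambda>q. mat 1) p"
    by (rule pd_cong_open[OF open_S assms coframe_frame
        differentiable_matrix_mult[OF differentiable_E[OF assms] differentiable_F[OF assms]]])
  then show ?thesis
    using pd_matrix_mult[OF differentiable_E[OF assms] differentiable_F[OF assms]] by simp
qed

lemma coframe_connection_matrix:
  assumes "p \<in> S"
  shows "E p ** connection_matrix i p = pd i E p + A i p ** E p"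
proof -
  have "E p ** pd i F p = - (pd i E p ** F p)"
    using pd_E[OF assms, of i] by (simp add: eq_neg_iff_add_eq_0)
  then have "E p ** connection_matrix i p = (A i p + pd i E p ** F p) ** E p"
    using coframe_frame[OF assms]
    by (simp add: connection_matrix_def matrix_mul_assoc matrix_mult_bilinear)
  also have "\<dots> = pd i E p + A i p ** E p"
    using frame_coframe[OF assms] by (simp add: matrix_mult_bilinear matrix_mul_assoc[symmetric])
  finally show ?thesis .
qed

lemma connection_matrix_eq:
  assumes "p \<in> S"
  shows "connection_matrix i p = F p ** (pd i E p + A i p ** E p)"
  using coframe_connection_matrix[OF assms, of i] frame_coframe[OF assms]
  by (metis matrix_mul_assoc matrix_mul_lid)

lemma connection_matrix_sym:
  assumes "p \<in> S"
  shows "connection_matrix i p $ k $ j = connection_matrix j p $ k $ i"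
  unfolding connection_matrix_eq[OF assms] matrix_matrix_mult_def[of "F p"]
  by (simp add: torsion_free[OF assms, of i _ j])

lemma metric_inverse:
  assumes "p \<in> S"
  shows "matrix_inv (g p) = (1 / f p) *\<^sub>R (F p ** transpose (F p))"
proof (rule matrix_inv_eqI)
  have "transpose (E p) ** (E p ** F p) ** transpose (F p) = transpose (F p ** E p)"
    by (simp add: coframe_frame[OF assms] matrix_transpose_mul)
  then have "transpose (E p) ** E p ** F p ** transpose (F p) = mat 1"
    by (simp add: matrix_mul_assoc frame_coframe[OF assms])
  then show "g p ** ((1 / f p) *\<^sub>R (F p ** transpose (F p))) = mat 1"
    using factor_nonzero[OF assms]
    by (simp add: metric[OF assms] matrix_mul_assoc matrix_mult_bilinear)
qed

lemma differentiable_metric: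
  assumes "p \<in> S"
  shows "g differentiable (at p)"
proof -
  have "(\<lambda>q. f q *\<^sub>R (transpose (E q) ** E q)) differentiable (at p)"
    using assms differentiable_E differentiable_f
    by (intro differentiable_bounded_bilinear[OF bounded_bilinear_scaleR]
        differentiable_matrix_mult differentiable_bounded_linear[OF bounded_linear_transpose])
  then show ?thesis
    by (rule differentiable_cong_open[OF open_S assms, rotated]) (simp add: metric)
qed

lemma pd_metric:
  assumes "p \<in> S"
  shows "pd i g p = transpose (connection_matrix i p) ** g p + g p ** connection_matrix i p"
proof -
  let ?E = "E p" and ?dE = "pd i E p" and ?A = "A i p"
  note dE = differentiable_E[OF assms] and df = differentiable_f[OF assms]
  note lin = bounded_linear_transpose
  note dET = differentiable_bounded_linear[OF lin dE]
  note dEE = differentiable_matrix_mult[OF dET dE]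
  have dg: "(\<lambda>q. f q *\<^sub>R (transpose (E q) ** E q)) differentiable (at p)"
    by (rule differentiable_bounded_bilinear[OF bounded_bilinear_scaleR df dEE])
  have "pd i g p = pd i (\<lambda>q. f q *\<^sub>R (transpose (E q) ** E q)) p"
    by (rule pd_cong_open[OF open_S assms, symmetric, OF _ dg]) (simp add: metric)
  also have "\<dots> = f p *\<^sub>R (transpose ?E ** ?dE + transpose ?dE ** ?E)
      + pd i f p *\<^sub>R (transpose ?E ** ?E)"
    by (simp add: pd_bounded_bilinear[OF bounded_bilinear_scaleR df dEE]
        pd_matrix_mult[OF dET dE] pd_bounded_linear[OF lin dE])
  also have "pd i f p *\<^sub>R (transpose ?E ** ?E) =
      f p *\<^sub>R (transpose ?E ** (?A + transpose ?A) ** ?E)"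
    using factor_nonzero[OF assms]
    by (simp add: metric_connection[OF assms] vec_eq_iff matrix_matrix_mult_def mat_def
        sum_distrib_left if_distrib if_distribR mult.left_commute mult.assoc cong: if_cong)
  finally have "pd i g p = f p *\<^sub>R (transpose ?E ** (?dE + ?A ** ?E)
      + transpose (?dE + ?A ** ?E) ** ?E)"
    by (simp add: matrix_mult_bilinear matrix_transpose_mul matrix_mul_assoc
        scaleR_add_right bounded_linear.linear[OF lin, THEN linear_add])
  also have "\<dots> = transpose (connection_matrix i p) ** g p + g p ** connection_matrix i p"
    by (simp add: metric[OF assms] coframe_connection_matrix[OF assms, symmetric] matrix_transpose_mul
        matrix_mul_assoc matrix_mult_bilinear scaleR_add_right)
  finally show ?thesis .
qed

text \<open>
  The fundamental theorem of Riemannian geometry: the connection matrices are symmetric in the lower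
  indices (\<open>connection_matrix_sym\<close>) and satisfy \<open>\<partial>\<^sub>i g = \<Gamma>\<^sub>i\<^sup>T g + g \<Gamma>\<^sub>i\<close> (\<open>pd_metric\<close>), which leaves
  the Christoffel symbols as the only possibility.
\<close>

lemma christoffel_frame:
  assumes "p \<in> S"
  shows "christoffel g k i j p = connection_matrix i p $ k $ j"
proof -
  \<comment> \<open>the symbol with all indices lowered\<close>
  define H where "H i j l = (g p ** connection_matrix i p) $ l $ j" for i j l
  have sym: "transpose (g p) = g p"
    by (simp add: metric[OF assms] transpose_scalar matrix_transpose_mul)
  have H: "pd i (\<lambda>q. g q $ j $ l) p = H i j l + H i l j" for i j l
  proof -
    have "(transpose (connection_matrix i p) ** g p) $ j $ l = transpose (g p ** connection_matrix i p) $ j $ l"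
      by (simp add: matrix_transpose_mul sym)
    then show ?thesis
      using differentiable_metric[OF assms]
      by (simp add: pd_nth pd_metric[OF assms] H_def transpose_def)
  qed
  have H_sym: "H i j l = H j i l" for i j l
    by (simp add: H_def matrix_matrix_mult_def connection_matrix_sym[OF assms, of i _ j])
  have "christoffel g k i j p = (\<Sum>l\<in>UNIV. matrix_inv (g p) $ k $ l * (2 * H i j l)) / 2"
    unfolding christoffel_def H using H_sym[of j l i for l] H_sym[of i l j for l] H_sym[of j i]
    by simp
  also have "\<dots> = (matrix_inv (g p) ** (g p ** connection_matrix i p)) $ k $ j"
    by (simp add: H_def matrix_matrix_mult_def[of "matrix_inv (g p)"] sum_distrib_left[symmetric]
        mult.left_commute)
  also have "matrix_inv (g p) ** (g p ** connection_matrix i p) = connection_matrix i p"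
  proof -
    have "(F p ** transpose (F p)) ** (transpose (E p) ** E p) = mat 1"
    proof -
      have "(F p ** transpose (F p)) ** (transpose (E p) ** E p)
          = F p ** transpose (E p ** F p) ** E p"
        by (simp add: matrix_transpose_mul matrix_mul_assoc)
      then show ?thesis
        by (simp add: coframe_frame[OF assms] frame_coframe[OF assms])
    qed
    then have "matrix_inv (g p) ** g p = mat 1"
      using factor_nonzero[OF assms]
      unfolding metric_inverse[OF assms] by (simp add: metric[OF assms] matrix_mult_bilinear)
    then show ?thesis by (simp add: matrix_mul_assoc)
  qed
  finally show ?thesis .
qed

definition curvature_form :: "'n \<Rightarrow> 'n \<Rightarrow> real^'n \<Rightarrow> real^'n^'n" where
  "curvature_form i j p =
     pd i (A j) p - pd j (A i) p + (A i p ** A j p - A j p ** A i p)"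

lemma differentiable_connection_matrix: "p \<in> S \<Longrightarrow> connection_matrix i differentiable (at p)"
  unfolding connection_matrix_def[abs_def]
  by (intro differentiable_matrix_mult differentiable_diff differentiable_F differentiable_A
      differentiable_pd_F differentiable_E)

lemma connection_matrix_frame: "p \<in> S \<Longrightarrow> connection_matrix i p ** F p = F p ** A i p - pd i F p"
  by (simp add: connection_matrix_def matrix_mul_assoc[symmetric] coframe_frame)

text \<open>
  Differentiating \<open>\<Gamma>\<^sub>j F = F A\<^sub>j - \<partial>\<^sub>j F\<close> gives the derivative of \<open>\<Gamma>\<^sub>j\<close> up to second derivatives of
  \<open>F\<close>, and these cancel from the curvature because they are symmetric.
\<close>

lemma pd_connection_matrix_frame:
  assumes "p \<in> S"
  shows "pd i (connection_matrix j) p ** F p =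
    F p ** pd i (A j) p + pd i F p ** A j p - pd i (pd j F) p - connection_matrix j p ** pd i F p"
proof -
  note d = differentiable_F[OF assms] differentiable_A[OF assms] differentiable_connection_matrix[OF assms]
    differentiable_pd_F[OF assms]
  have "pd i (\<lambda>q. connection_matrix j q ** F q) p = pd i (\<lambda>q. F q ** A j q - pd j F q) p"
    by (rule pd_cong_open[OF open_S assms])
      (use connection_matrix_frame d in \<open>auto intro: differentiable_matrix_mult\<close>)
  then show ?thesis
    by (simp add: pd_matrix_mult d differentiable_matrix_mult algebra_simps)
qed

lemma curv_coeff_frame:
  assumes "p \<in> S"
  shows "curv_coeff g l i j k p = (F p ** curvature_form i j p ** E p) $ l $ k"
proof -
  let ?R = "pd i (connection_matrix j) p - pd j (connection_matrix i) p +
    (connection_matrix i p ** connection_matrix j p - connection_matrix j p ** connection_matrix i p)"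
  have "pd i (christoffel g l j k) p = pd i (connection_matrix j) p $ l $ k" for i j
  proof -
    have "pd i (\<lambda>q. connection_matrix j q $ l $ k) p = pd i (christoffel g l j k) p"
      by (rule pd_cong_open[OF open_S assms])
        (use christoffel_frame differentiable_connection_matrix[OF assms] in auto)
    then show ?thesis using differentiable_connection_matrix[OF assms] by (simp add: pd_nth)
  qed
  then have "curv_coeff g l i j k p = ?R $ l $ k"
    by (simp add: curv_coeff_def christoffel_frame[OF assms] matrix_matrix_mult_def sum_subtractf)
  moreover have "?R = ?R ** F p ** E p"
    by (simp add: matrix_mul_assoc[symmetric] frame_coframe[OF assms])
  moreover have "?R ** F p = F p ** curvature_form i j p"
  proof -
    have GG: "connection_matrix i p ** connection_matrix j p ** F p =
        F p ** A i p ** A j p - pd i F p ** A j p - connection_matrix i p ** pd j F p" for i j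
      by (simp add: matrix_mul_assoc[symmetric] connection_matrix_frame[OF assms] matrix_mult_bilinear)
        (simp add: matrix_mul_assoc connection_matrix_frame[OF assms] matrix_mult_bilinear)
    show ?thesis
      by (simp add: matrix_mult_bilinear pd_connection_matrix_frame[OF assms] GG curvature_form_def
          matrix_mult_bilinear matrix_mul_assoc mixed_pd_F[OF assms, of i j])
  qed
  ultimately show ?thesis by metis
qed

lemma riem_frame:
  assumes "p \<in> S"
  shows "riem g p X Y Z W =
    f p * (((\<Sum>i\<in>UNIV. \<Sum>j\<in>UNIV. (X $ i * Y $ j) *\<^sub>R curvature_form i j p) *v (E p *v Z)) \<bullet> (E p *v W))"
proof -
  let ?Om = "\<Sum>i\<in>UNIV. \<Sum>j\<in>UNIV. (X $ i * Y $ j) *\<^sub>R curvature_form i j p"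
  have "curv_op g p X Y Z = F p *v (?Om *v (E p *v Z))"
  proof -
    have "?Om *v (E p *v Z) = (\<Sum>i\<in>UNIV. \<Sum>j\<in>UNIV.
        (X $ i * Y $ j) *\<^sub>R (curvature_form i j p *v (E p *v Z)))"
      by (simp add: matrix_vector_sum_left scaleR_matrix_vector_assoc[symmetric])
    then have "F p *v (?Om *v (E p *v Z)) = (\<Sum>i\<in>UNIV. \<Sum>j\<in>UNIV. (X $ i * Y $ j) *\<^sub>R
        ((F p ** curvature_form i j p ** E p) *v Z))"
      by (simp add: linear_sum[OF matrix_vector_mul_linear] matrix_vector_mult_scaleR
          matrix_vector_mul_assoc matrix_mul_assoc)
    then show ?thesis
      by (simp add: curv_op_def vec_eq_iff curv_coeff_frame[OF assms] matrix_vector_mult_def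
          sum_distrib_left mult.assoc mult.commute mult.left_commute)
  qed
  moreover have "metric_ip g p (F p *v V) W = f p * (V \<bullet> (E p *v W))" for V
    by (simp add: metric_ip_def metric[OF assms] scaleR_matrix_vector_assoc[symmetric])
      (metis (no_types, lifting) coframe_frame[OF assms] dot_lmul_matrix
        matrix_vector_mul_assoc matrix_vector_mul_lid transpose_matrix_vector transpose_transpose)
  ultimately show ?thesis by (simp add: riem_def)
qed

lemma pd_constant_frame_endo:
  assumes "p \<in> S"
  shows "(\<lambda>q. F q ** K ** E q) differentiable (at p)"
    and "pd i (\<lambda>q. F q ** K ** E q) p = F p ** K ** pd i E p + pd i F p ** K ** E p"
  using differentiable_E[OF assms] differentiable_F[OF assms]
  by (simp_all add: pd_matrix_mult differentiable_matrix_mult)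

lemma cov_endo_coeff_frame:
  assumes "p \<in> S"
  shows "cov_endo_coeff g (\<lambda>q. F q ** K ** E q) k i j p =
    (F p ** (A i p ** K - K ** A i p) ** E p) $ k $ j"
proof -
  let ?B = "\<lambda>q. F q ** K ** E q"
  have "cov_endo_coeff g ?B k i j p =
      (pd i ?B p + (connection_matrix i p ** ?B p - ?B p ** connection_matrix i p)) $ k $ j"
    using pd_constant_frame_endo[OF assms]
    by (simp add: pd_nth cov_endo_coeff_def christoffel_frame[OF assms]
        matrix_matrix_mult_def[of "connection_matrix i p"] matrix_matrix_mult_def[of _ "connection_matrix i p"] sum_subtractf mult.commute)
  also have "pd i ?B p + (connection_matrix i p ** ?B p - ?B p ** connection_matrix i p) =
      F p ** (A i p ** K - K ** A i p) ** E p"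
  proof -
    have "connection_matrix i p ** ?B p = (F p ** A i p - pd i F p) ** K ** E p"
      by (simp add: matrix_mul_assoc connection_matrix_frame[OF assms])
    moreover have "?B p ** connection_matrix i p = F p ** K ** (pd i E p + A i p ** E p)"
      by (simp add: matrix_mul_assoc[symmetric] coframe_connection_matrix[OF assms])
    ultimately show ?thesis
      by (simp add: pd_constant_frame_endo[OF assms] matrix_mult_bilinear matrix_mul_assoc)
  qed
  finally show ?thesis .
qed

text \<open>
  In the Nijenhuis tensor partial derivatives may be replaced by covariant derivatives for any
  symmetric connection: the extra terms cancel in pairs.
\<close>

lemma nijenhuis_cov_endo:
  assumes p: "p \<in> S" and B: "B differentiable (at p)"
  shows "nijenhuis B k i j p = (\<Sum>a\<in>UNIV.
      B p $ a $ i * cov_endo_coeff g B k a j p - B p $ a $ j * cov_endo_coeff g B k a i p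
    + B p $ k $ a * (cov_endo_coeff g B a j i p - cov_endo_coeff g B a i j p))"
proof -
  define \<Gamma> where "\<Gamma> k i j = connection_matrix i p $ k $ j" for k i j
  define b where "b = B p"
  have \<Gamma>_sym: "\<Gamma> k i j = \<Gamma> k j i" for k i j
    by (simp add: \<Gamma>_def connection_matrix_sym[OF p, of i k j])
  define T1 where "T1 i j = (\<Sum>a\<in>UNIV. \<Sum>c\<in>UNIV. b $ a $ i * (\<Gamma> k a c * b $ c $ j))" for i j
  define T2 where "T2 i j = (\<Sum>a\<in>UNIV. \<Sum>c\<in>UNIV. b $ a $ i * (\<Gamma> c a j * b $ k $ c))" for i j
  define T3 where "T3 i j = (\<Sum>a\<in>UNIV. \<Sum>c\<in>UNIV. b $ k $ a * (\<Gamma> a j c * b $ c $ i))" for i j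
  define T4 where "T4 i j = (\<Sum>a\<in>UNIV. \<Sum>c\<in>UNIV. b $ k $ a * (\<Gamma> c j i * b $ a $ c))" for i j
  have T1: "T1 i j = T1 j i"
    unfolding T1_def by (subst sum.swap) (simp add: \<Gamma>_sym[of k] mult_ac)
  have T23: "T3 i j = T2 i j" for i j
    unfolding T2_def T3_def by (subst sum.swap) (simp add: \<Gamma>_sym[of _ j] mult_ac)
  have T4: "T4 i j = T4 j i"
    unfolding T4_def by (simp add: \<Gamma>_sym[of _ i])
  have cov: "cov_endo_coeff g B k i j p = pd i (\<lambda>q. B q $ k $ j) p
     + (\<Sum>c\<in>UNIV. \<Gamma> k i c * b $ c $ j - \<Gamma> c i j * b $ k $ c)" for k i j
    by (simp add: cov_endo_coeff_def christoffel_frame[OF p] \<Gamma>_def b_def)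
  have "(\<Sum>a\<in>UNIV. b $ a $ i * (\<Sum>c\<in>UNIV. \<Gamma> k a c * b $ c $ j - \<Gamma> c a j * b $ k $ c)
      - b $ a $ j * (\<Sum>c\<in>UNIV. \<Gamma> k a c * b $ c $ i - \<Gamma> c a i * b $ k $ c)
      + b $ k $ a * ((\<Sum>c\<in>UNIV. \<Gamma> a j c * b $ c $ i - \<Gamma> c j i * b $ a $ c)
        - (\<Sum>c\<in>UNIV. \<Gamma> a i c * b $ c $ j - \<Gamma> c i j * b $ a $ c)))
    = (T1 i j - T2 i j) - (T1 j i - T2 j i) + ((T3 i j - T4 i j) - (T3 j i - T4 j i))"
    unfolding T1_def T2_def T3_def T4_def
    by (simp only: sum_subtractf sum.distrib sum_distrib_left right_diff_distrib)
  also have "\<dots> = 0"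
    using T1 T4 by (simp add: T23)
  finally show ?thesis
    unfolding nijenhuis_def cov b_def[symmetric]
    by (simp add: ring_distribs sum.distrib sum_subtractf)
qed

text \<open>
  For an endomorphism \<open>B = F K E\<close> with constant matrix \<open>K\<close> in the frame, \<open>\<nabla>\<^sub>i B\<close> is represented by the
  commutator of \<open>A\<^sub>i\<close> and \<open>K\<close>. The hypothesis \<open>cr\<close> is thus \<open>\<nabla>\<^sub>B\<^sub>X B = B \<nabla>\<^sub>X B\<close>, under which the four
  terms of the Nijenhuis tensor cancel.
\<close>

lemma nijenhuis_frame_eq_0:
  assumes p: "p \<in> S"
    and cr: "\<And>i. (\<Sum>a\<in>UNIV. (F p ** K ** E p) $ a $ i *\<^sub>R (A a p ** K - K ** A a p)) =
      K ** (A i p ** K - K ** A i p)"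
  shows "nijenhuis (\<lambda>q. F q ** K ** E q) k i j p = 0"
proof -
  let ?B = "F p ** K ** E p" and ?C = "\<lambda>i. A i p ** K - K ** A i p"
  have eq: "(\<Sum>a\<in>UNIV. ?B $ a $ i * (F p ** ?C a ** E p) $ k $ j) =
    (\<Sum>a\<in>UNIV. ?B $ k $ a * (F p ** ?C i ** E p) $ a $ j)" for i j
  proof -
    have "(\<Sum>a\<in>UNIV. ?B $ a $ i * (F p ** ?C a ** E p) $ k $ j) =
        (F p ** (\<Sum>a\<in>UNIV. ?B $ a $ i *\<^sub>R ?C a) ** E p) $ k $ j"
      by (simp add: matrix_mult_bilinear)
    also have "\<dots> = (F p ** K ** (E p ** F p) ** ?C i ** E p) $ k $ j"
      by (simp add: cr coframe_frame[OF p] matrix_mul_assoc)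
    also have "\<dots> = (?B ** (F p ** ?C i ** E p)) $ k $ j"
      by (simp add: matrix_mul_assoc)
    finally show ?thesis by (simp add: matrix_matrix_mult_def[of ?B])
  qed
  show ?thesis
    unfolding nijenhuis_cov_endo[OF p pd_constant_frame_endo(1)[OF p]] cov_endo_coeff_frame[OF p]
    using eq[of i j] eq[of j i] by (simp add: sum.distrib sum_subtractf right_diff_distrib)
qed

text \<open>
  In the orthogonal frame the norm of a tensor is a sum of squares of its components. Each of the
  two lower indices contributes a factor \<open>1 / f\<close> and the upper index a factor \<open>f\<close>.
\<close>

lemma cov_endo_norm_frame:
  assumes p: "p \<in> S"
  shows "cov_endo_norm g (\<lambda>q. F q ** K ** E q) p = sqrt
    ((\<Sum>c\<in>UNIV. \<Sum>b\<in>UNIV. \<Sum>a\<in>UNIV.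
       (\<Sum>i\<in>UNIV. F p $ i $ a * (A i p ** K - K ** A i p) $ c $ b)\<^sup>2) / f p)"
proof -
  define C where "C i = A i p ** K - K ** A i p" for i
  define T where "T k i j = (F p ** C i ** E p) $ k $ j" for k i j
  have out: "(\<Sum>i\<in>UNIV. \<Sum>j\<in>UNIV. \<Sum>a\<in>I. h i j a) = (\<Sum>a\<in>I. \<Sum>i\<in>UNIV. \<Sum>j\<in>UNIV. h i j a)"
    for h :: "'n \<Rightarrow> 'n \<Rightarrow> 'c \<Rightarrow> real" and I
    by (subst sum.swap[of _ I]) (intro sum.cong refl sum.swap)
  \<comment> \<open>contraction of one index pair with a Gram matrix; the set \<open>I\<close> carries the indices that were
    already contracted\<close>
  have gram: "(\<Sum>i\<in>UNIV. \<Sum>i'\<in>UNIV. (\<Sum>a\<in>UNIV. N a i * N a i') * (\<Sum>c\<in>I. x c i * y c i')) =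
      (\<Sum>c\<in>I. \<Sum>a\<in>UNIV. (\<Sum>i\<in>UNIV. N a i * x c i) * (\<Sum>i'\<in>UNIV. N a i' * y c i'))"
    for N :: "'n \<Rightarrow> 'n \<Rightarrow> real" and x y :: "'c \<Rightarrow> 'n \<Rightarrow> real" and I
  proof -
    have "(\<Sum>i\<in>UNIV. \<Sum>i'\<in>UNIV. (\<Sum>a\<in>UNIV. N a i * N a i') * (x c i * y c i')) =
        (\<Sum>a\<in>UNIV. (\<Sum>i\<in>UNIV. N a i * x c i) * (\<Sum>i'\<in>UNIV. N a i' * y c i'))" for c
      unfolding sum_product by (subst out[symmetric]) (simp add: sum_distrib_left mult_ac)
    then show ?thesis
      unfolding sum_distrib_left by (subst out) simp
  qed
  have f: "f p \<noteq> 0" and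
    g: "g p $ k $ k' = f p * (\<Sum>c\<in>UNIV. E p $ c $ k * E p $ c $ k')" and
    ginv: "matrix_inv (g p) $ k $ k' = (1 / f p) * (\<Sum>c\<in>UNIV. F p $ k $ c * F p $ k' $ c)" for k k'
    using factor_nonzero[OF p] unfolding metric_inverse[OF p]
    by (simp_all add: metric[OF p] matrix_matrix_mult_def transpose_def)
  \<comment> \<open>\<open>V\<close> has the upper index in the frame, \<open>W\<close> also the lower index \<open>j\<close>\<close>
  define V where "V c i j = (\<Sum>k\<in>UNIV. E p $ c $ k * T k i j)" for c i j
  define W where "W b c i = (\<Sum>j\<in>UNIV. F p $ j $ b * V c i j)" for b c i
  have W: "W b c i = C i $ c $ b" for b c i
  proof -
    have "W b c i = (E p ** (F p ** C i ** E p) ** F p) $ c $ b"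
      by (simp add: W_def V_def T_def matrix_matrix_mult_def[of _ "F p"]
          matrix_matrix_mult_def[of "E p" "_ ** _"] mult.commute)
    also have "E p ** (F p ** C i ** E p) ** F p = (E p ** F p) ** C i ** (E p ** F p)"
      by (simp only: matrix_mul_assoc)
    finally show ?thesis by (simp add: coframe_frame[OF p])
  qed
  have V1: "(\<Sum>k\<in>UNIV. \<Sum>k'\<in>UNIV. (\<Sum>c\<in>UNIV. E p $ c $ k * E p $ c $ k') *
      (\<Sum>c\<in>{()}. T k i j * T k' i' j')) = (\<Sum>c\<in>UNIV. V c i j * V c i' j')" for i j i' j'
    unfolding gram by (simp add: V_def)
  have V2: "(\<Sum>j\<in>UNIV. \<Sum>j'\<in>UNIV. (\<Sum>b\<in>UNIV. F p $ j $ b * F p $ j' $ b) *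
      (\<Sum>c\<in>UNIV. V c i j * V c i' j')) =
      (\<Sum>cb\<in>UNIV \<times> UNIV. W (snd cb) (fst cb) i * W (snd cb) (fst cb) i')" for i i'
    unfolding gram by (simp add: W_def sum.cartesian_product case_prod_beta)
  have "(\<Sum>i\<in>UNIV. \<Sum>i'\<in>UNIV. \<Sum>j\<in>UNIV. \<Sum>j'\<in>UNIV. \<Sum>k\<in>UNIV. \<Sum>k'\<in>UNIV.
        matrix_inv (g p) $ i $ i' * matrix_inv (g p) $ j $ j' * g p $ k $ k' * T k i j * T k' i' j')
    = (\<Sum>i\<in>UNIV. \<Sum>i'\<in>UNIV. matrix_inv (g p) $ i $ i' *
        (\<Sum>j\<in>UNIV. \<Sum>j'\<in>UNIV. matrix_inv (g p) $ j $ j' *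
          (f p * (\<Sum>k\<in>UNIV. \<Sum>k'\<in>UNIV. (\<Sum>c\<in>UNIV. E p $ c $ k * E p $ c $ k') *
            (\<Sum>c\<in>{()}. T k i j * T k' i' j')))))"
    by (simp add: g sum_distrib_left mult_ac)
  also have "\<dots> = (\<Sum>i\<in>UNIV. \<Sum>i'\<in>UNIV. matrix_inv (g p) $ i $ i' *
        (\<Sum>j\<in>UNIV. \<Sum>j'\<in>UNIV. (\<Sum>b\<in>UNIV. F p $ j $ b * F p $ j' $ b) *
          (\<Sum>c\<in>UNIV. V c i j * V c i' j')))"
    unfolding V1 ginv using f by simp
  also have "\<dots> = (1 / f p) * (\<Sum>i\<in>UNIV. \<Sum>i'\<in>UNIV. (\<Sum>a\<in>UNIV. F p $ i $ a * F p $ i' $ a) *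
        (\<Sum>cb\<in>UNIV \<times> UNIV. W (snd cb) (fst cb) i * W (snd cb) (fst cb) i'))"
    unfolding V2 ginv mult.assoc sum_distrib_left[symmetric] by (simp add: sum_divide_distrib)
  also have "\<dots> = (\<Sum>c\<in>UNIV. \<Sum>b\<in>UNIV. \<Sum>a\<in>UNIV. (\<Sum>i\<in>UNIV. F p $ i $ a * C i $ c $ b)\<^sup>2) / f p"
    unfolding gram W
    using sum.cartesian_product[of "\<lambda>c b. \<Sum>a\<in>UNIV. (\<Sum>i\<in>UNIV. F p $ i $ a * C i $ c $ b)\<^sup>2" UNIV UNIV]
    by (simp add: power2_eq_square case_prod_beta)
  finally show ?thesis
    unfolding cov_endo_norm_def cov_endo_coeff_frame[OF p] C_def T_def
    by simp
qed

end

section \<open>A unitary frame for the instanton up to scale\<close>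

definition \<sigma> :: "real^4 \<Rightarrow> real" where
  "\<sigma> p = 1 + (p $ 1)\<^sup>2 + (p $ 2)\<^sup>2"

text \<open>
  With the reciprocal as a function of its own all components below are polynomials in \<open>u, v, y, \<rho>\<close>,
  and identities between them are ideal membership modulo \<open>\<rho> (1 + u\<^sup>2 + v\<^sup>2) = 1\<close>.
\<close>

definition \<rho> :: "real^4 \<Rightarrow> real" where
  "\<rho> p = 1 / \<sigma> p"

text \<open>
  The columns are \<open>\<partial>\<^sub>u + v (v \<partial>\<^sub>u - u \<partial>\<^sub>v)\<close>, \<open>\<partial>\<^sub>v - u (v \<partial>\<^sub>u - u \<partial>\<^sub>v)\<close>, \<open>\<partial>\<^sub>y\<close>
  and the horizontal lift \<open>\<partial>\<^sub>t + 2y (v \<partial>\<^sub>u - u \<partial>\<^sub>v)\<close> of \<open>\<partial>\<^sub>t\<close>.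
\<close>

definition frame :: "real^4 \<Rightarrow> real^4^4" where
  "frame p = (let u = p $ 1; v = p $ 2; y = p $ 3 in
     vector [vector [1 + v\<^sup>2, - (u * v), 0, 2 * y * v],
             vector [- (u * v), 1 + u\<^sup>2, 0, - (2 * y * u)],
             vector [0, 0, 1, 0],
             vector [0, 0, 0, 1]])"

text \<open>
  The first two rows are the real and imaginary part of \<open>\<theta> = (dz + z (d\<sigma> / 2 + 2iy dt)) / \<sigma>\<close>, the
  last two those of \<open>\<beta> = dy + i dt\<close>.
\<close>

definition coframe :: "real^4 \<Rightarrow> real^4^4" where
  "coframe p = (let u = p $ 1; v = p $ 2; y = p $ 3 in
     vector [vector [\<rho> p * (1 + u\<^sup>2), \<rho> p * (u * v), 0, - (\<rho> p * (2 * y * v))],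
             vector [\<rho> p * (u * v), \<rho> p * (1 + v\<^sup>2), 0, \<rho> p * (2 * y * u)],
             vector [0, 0, 1, 0],
             vector [0, 0, 0, 1]])"

text \<open>
  A vector with frame components \<open>(\<xi>\<^sub>1, \<xi>\<^sub>2, \<xi>\<^sub>3, \<xi>\<^sub>4)\<close> is read as the pair
  \<open>(z\<^sub>1, z\<^sub>2) = (\<xi>\<^sub>1 + i\<xi>\<^sub>2, \<xi>\<^sub>3 + i\<xi>\<^sub>4)\<close> of complex numbers. The following matrices are the basis
  \<open>(iz\<^sub>1, 0)\<close>, \<open>(0, iz\<^sub>2)\<close>, \<open>(z\<^sub>2, -z\<^sub>1)\<close>, \<open>(iz\<^sub>2, iz\<^sub>1)\<close> of the Lie algebra \<open>u(2)\<close>.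
\<close>

definition "KD = (vector [vector [0, - 1, 0, 0], vector [1, 0, 0, 0], 0, 0] :: real^4^4)"
definition "KN = (vector [0, 0, vector [0, 0, 0, - 1], vector [0, 0, 1, 0]] :: real^4^4)"
definition "KP = (vector [vector [0, 0, 1, 0], vector [0, 0, 0, 1],
  vector [- 1, 0, 0, 0], vector [0, - 1, 0, 0]] :: real^4^4)"
definition "KQ = (vector [vector [0, 0, 0, - 1], vector [0, 0, 1, 0],
  vector [0, - 1, 0, 0], vector [1, 0, 0, 0]] :: real^4^4)"

definition conformal_unitary :: "real \<Rightarrow> real \<Rightarrow> real \<Rightarrow> real \<Rightarrow> real \<Rightarrow> real^4^4" where
  "conformal_unitary l a b m n = l *\<^sub>R mat 1 + a *\<^sub>R KD + b *\<^sub>R KN + m *\<^sub>R KP + n *\<^sub>R KQ"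

text \<open>
  The connection form is \<open>d\<sigma> / (2\<sigma>) + \<psi>\<close> with \<open>\<psi>\<close> in \<open>u(2)\<close>; the equations
  \<open>d\<theta> + \<dots> = 0\<close> and \<open>d\<beta> + \<dots> = 0\<close> of torsion-freeness determine \<open>\<psi>\<close>. In terms of
  \<open>\<eta> = u dv - v du + 2 (\<sigma> - 1) y dt\<close> its entries are \<open>\<psi>\<^sub>1\<^sub>1 = i (2y dt - (\<sigma> + 1) \<eta> / \<sigma>\<^sup>2)\<close>,
  \<open>\<psi>\<^sub>2\<^sub>2 = i \<eta> / \<sigma>\<^sup>2\<close> and \<open>\<psi>\<^sub>1\<^sub>2 = - (z / \<sigma>) (dy - i dt)\<close>. The forms below are \<open>d\<sigma> / (2\<sigma>)\<close>,
  the imaginary parts of \<open>\<psi>\<^sub>1\<^sub>1\<close> and \<open>\<psi>\<^sub>2\<^sub>2\<close>, and the real and imaginary part of \<open>\<psi>\<^sub>1\<^sub>2\<close>.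
\<close>

definition lform :: "real^4 \<Rightarrow> real^4" where
  "lform p = vector [\<rho> p * p $ 1, \<rho> p * p $ 2, 0, 0]"

definition aform :: "real^4 \<Rightarrow> real^4" where
  "aform p = vector [(\<rho> p + (\<rho> p)\<^sup>2) * p $ 2, - ((\<rho> p + (\<rho> p)\<^sup>2) * p $ 1), 0,
     2 * (\<rho> p)\<^sup>2 * p $ 3]"

definition bform :: "real^4 \<Rightarrow> real^4" where
  "bform p = vector [- ((\<rho> p)\<^sup>2 * p $ 2), (\<rho> p)\<^sup>2 * p $ 1, 0,
     2 * (\<rho> p - (\<rho> p)\<^sup>2) * p $ 3]"

definition mform :: "real^4 \<Rightarrow> real^4" where
  "mform p = vector [0, 0, - (\<rho> p * p $ 1), - (\<rho> p * p $ 2)]"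

definition nform :: "real^4 \<Rightarrow> real^4" where
  "nform p = vector [0, 0, - (\<rho> p * p $ 2), \<rho> p * p $ 1]"

definition connection :: "4 \<Rightarrow> real^4 \<Rightarrow> real^4^4" where
  "connection i p = conformal_unitary (lform p $ i) (aform p $ i) (bform p $ i)
     (mform p $ i) (nform p $ i)"

lemmas matrix4_simps = vec_eq_iff forall_4 sum_4 matrix_matrix_mult_def transpose_def mat_def Let_def

lemma \<sigma>_pos [simp]: "\<sigma> p > 0" "\<sigma> p \<noteq> 0"
  by (simp_all add: \<sigma>_def add_pos_nonneg add_nonneg_pos) (smt (verit) zero_le_power2)+

lemma smooth_\<sigma>: "open S \<Longrightarrow> smooth_on S \<sigma>"
  unfolding \<sigma>_def[abs_def] by (intro smooth_on_add smooth_on_const smooth_on_power2 smooth_on_nth)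

lemma differentiable_\<sigma> [simp]: "\<sigma> differentiable (at p)"
  using smooth_\<sigma>[of UNIV] smooth_on_differentiable by blast

lemma pd_\<sigma> [simp]: "pd i \<sigma> p = (if i = 1 then 2 * p $ 1 else if i = 2 then 2 * p $ 2 else 0)"
  unfolding \<sigma>_def[abs_def] by simp

lemma \<rho>_rel: "\<rho> p * (1 + (p $ 1)\<^sup>2 + (p $ 2)\<^sup>2) = 1"
  using \<sigma>_pos(2)[of p] by (simp add: \<rho>_def \<sigma>_def)

lemma \<rho>_pos [simp]: "\<rho> p > 0" "\<rho> p \<noteq> 0"
  by (simp_all add: \<rho>_def)

lemma \<rho>_\<sigma> [simp]: "\<rho> p * \<sigma> p = 1" "\<sigma> p * \<rho> p = 1"
  by (simp_all add: \<rho>_def)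

lemma smooth_\<rho>: "open S \<Longrightarrow> smooth_on S \<rho>"
  unfolding \<rho>_def[abs_def] by (intro smooth_on_divide smooth_on_const smooth_\<sigma>) auto

lemma differentiable_\<rho> [simp]: "\<rho> differentiable (at p)"
  using smooth_\<rho>[of UNIV] smooth_on_differentiable by blast

lemma pd_\<rho> [simp]: "pd i \<rho> p = - (\<rho> p)\<^sup>2 * (if i = 1 then 2 * p $ 1 else if i = 2 then 2 * p $ 2 else 0)"
  unfolding \<rho>_def[abs_def] by (simp add: power_divide)

lemmas smooth_intros = smooth_\<rho> smooth_on_add smooth_on_diff smooth_on_minus smooth_on_mult smooth_on_power2
  smooth_on_divide smooth_on_const smooth_on_nth smooth_\<sigma>

lemma smooth_frame: "open S \<Longrightarrow> smooth_on S frame"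
proof (intro smooth_on_vec)
  fix a b :: 4
  assume S: "open S"
  show "smooth_on S (\<lambda>q. frame q $ a $ b)"
    using exhaust_4[of a] exhaust_4[of b] S
    by (elim disjE) (auto simp: frame_def Let_def intro!: smooth_intros)
qed

lemma smooth_coframe: "open S \<Longrightarrow> smooth_on S coframe"
proof (intro smooth_on_vec)
  fix a b :: 4
  assume S: "open S"
  show "smooth_on S (\<lambda>q. coframe q $ a $ b)"
    using exhaust_4[of a] exhaust_4[of b] S
    by (elim disjE) (auto simp: coframe_def Let_def intro!: smooth_intros)
qed

lemma smooth_forms:
  assumes S: "open S"
  shows "smooth_on S lform" "smooth_on S aform" "smooth_on S bform" "smooth_on S mform" "smooth_on S nform"
proof -
  have "smooth_on S (\<lambda>q. lform q $ a)" "smooth_on S (\<lambda>q. aform q $ a)" "smooth_on S (\<lambda>q. bform q $ a)"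
    "smooth_on S (\<lambda>q. mform q $ a)" "smooth_on S (\<lambda>q. nform q $ a)" for a
    using exhaust_4[of a] S
    by (elim disjE; auto simp: lform_def aform_def bform_def mform_def nform_def intro!: smooth_intros)+
  then show "smooth_on S lform" "smooth_on S aform" "smooth_on S bform" "smooth_on S mform" "smooth_on S nform"
    using smooth_on_vec[OF S] by blast+
qed

lemma smooth_connection: "open S \<Longrightarrow> smooth_on S (connection i)"
  unfolding connection_def[abs_def] conformal_unitary_def
  by (intro smooth_on_add smooth_on_bounded_bilinear[OF _ bounded_bilinear_scaleR] smooth_on_const
    smooth_on_bounded_linear[OF _ bounded_linear_vec_nth] smooth_forms)

lemma coframe_frame: "coframe p ** frame p = mat 1"
  by (simp add: coframe_def frame_def matrix4_simps, intro conjI; (algebra | use \<rho>_rel[of p] in algebra))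

lemma mixed_pd_frame: "pd i (pd j frame) p = pd j (pd i frame) p"
proof -
  have d: "frame differentiable (at q)" "pd k frame differentiable (at q)" for q k
    using smooth_frame[of UNIV] smooth_on_pd smooth_on_differentiable by blast+
  \<comment> \<open>Kronecker's symbol keeps the first derivatives uniform in the direction \<open>k\<close>\<close>
  define \<delta> where "\<delta> k l = (if l = k then 1 else 0 :: real)" for k l :: 4
  have first: "pd k frame q =
     vector [vector [2 * q $ 2 * \<delta> k 2, - (q $ 1 * \<delta> k 2 + \<delta> k 1 * q $ 2), 0,
               2 * (q $ 3 * \<delta> k 2 + \<delta> k 3 * q $ 2)],
             vector [- (q $ 1 * \<delta> k 2 + \<delta> k 1 * q $ 2), 2 * q $ 1 * \<delta> k 1, 0,
               - (2 * (q $ 3 * \<delta> k 1 + \<delta> k 3 * q $ 1))],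
             0, 0]" for k q
    unfolding vec_eq_iff forall_4
    by (simp add: pd_entry d) (simp add: frame_def Let_def \<delta>_def)
  show ?thesis
    unfolding vec_eq_iff forall_4 pd_entry[OF d(2)] first
    by (simp add: \<delta>_def)
qed

lemma connection_metric: "connection i p + transpose (connection i p) = mat (pd i \<sigma> p / \<sigma> p)"
  using exhaust_4[of i]
  by (elim disjE) (simp_all add: \<rho>_def connection_def conformal_unitary_def lform_def
      KD_def KN_def KP_def KQ_def matrix4_simps)

lemma antisymmetric_4_zeroI:
  fixes h :: "4 \<Rightarrow> 4 \<Rightarrow> real"
  assumes "\<And>i j. h i j = - h j i" "h 1 2 = 0" "h 1 3 = 0" "h 1 4 = 0" "h 2 3 = 0" "h 2 4 = 0" "h 3 4 = 0"
  shows "h i j = 0"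
proof -
  have "\<forall>i j. h i j = 0"
    unfolding forall_4 using assms(2-) assms(1)[of 1 1] assms(1)[of 2 2] assms(1)[of 3 3] assms(1)[of 4 4]
      assms(1)[of 2 1] assms(1)[of 3 1] assms(1)[of 4 1] assms(1)[of 3 2] assms(1)[of 4 2] assms(1)[of 4 3]
    by simp
  then show ?thesis by blast
qed

lemma connection_torsion_free:
  "pd i coframe p $ a $ j + (connection i p ** coframe p) $ a $ j =
   pd j coframe p $ a $ i + (connection j p ** coframe p) $ a $ i"
proof -
  have d: "coframe differentiable (at p)"
    using smooth_coframe[of UNIV] smooth_on_differentiable by blast
  let ?T = "\<lambda>i j. pd i coframe p $ a $ j + (connection i p ** coframe p) $ a $ j -
      (pd j coframe p $ a $ i + (connection j p ** coframe p) $ a $ i)"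
  have "?T i j = 0"
    by (rule antisymmetric_4_zeroI[of ?T];
      use exhaust_4[of a] in \<open>elim disjE; hypsubst_thin\<close>;
      simp add: pd_entry[OF d] connection_def conformal_unitary_def matrix_mult_bilinear;
      (simp add: coframe_def KD_def KN_def KP_def KQ_def lform_def aform_def bform_def mform_def nform_def
          matrix4_simps)?; (algebra | use \<rho>_rel[of p] in algebra))
  then show ?thesis by simp
qed

definition instanton_metric :: "real^4 \<Rightarrow> real^4^4" where
  "instanton_metric p = \<sigma> p *\<^sub>R (transpose (coframe p) ** coframe p)"

definition frame_endo :: "real^4^4 \<Rightarrow> real^4 \<Rightarrow> real^4^4" where
  "frame_endo K p = frame p ** K ** coframe p"

interpretation instanton: moving_frame UNIV coframe frame connection \<sigma> instanton_metric
proof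
  show "pd i coframe p $ a $ j + (connection i p ** coframe p) $ a $ j
      = pd j coframe p $ a $ i + (connection j p ** coframe p) $ a $ i" for p i j a
    by (rule connection_torsion_free)
qed (use smooth_frame[of UNIV] smooth_coframe[of UNIV] smooth_connection[of UNIV] in
    \<open>auto simp: instanton_metric_def coframe_frame mixed_pd_frame connection_metric
      intro: smooth_on_differentiable smooth_on_pd\<close>)

section \<open>Curvature\<close>

lemma conformal_unitary_add:
  "conformal_unitary l a b m n + conformal_unitary l' a' b' m' n' =
    conformal_unitary (l + l') (a + a') (b + b') (m + m') (n + n')"
  by (simp add: conformal_unitary_def scaleR_add_left)

lemma conformal_unitary_diff:
  "conformal_unitary l a b m n - conformal_unitary l' a' b' m' n' =
    conformal_unitary (l - l') (a - a') (b - b') (m - m') (n - n')"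
  by (simp add: conformal_unitary_def scaleR_diff_left)

lemma conformal_unitary_commutator:
  "conformal_unitary l a b m n ** conformal_unitary l' a' b' m' n'
   - conformal_unitary l' a' b' m' n' ** conformal_unitary l a b m n =
   conformal_unitary 0 (2 * (m * n' - n * m')) (- (2 * (m * n' - n * m')))
     ((b - a) * n' - n * (b' - a')) ((a - b) * m' - m * (a' - b'))"
  by (simp add: conformal_unitary_def KD_def KN_def KP_def KQ_def matrix4_simps) (intro conjI; algebra)

text \<open>Components of the 2-form \<open>\<theta>\<^sup>a \<and> \<theta>\<^sup>b\<close> in the standard coordinates.\<close>

definition coframe_wedge :: "4 \<Rightarrow> 4 \<Rightarrow> real^4 \<Rightarrow> 4 \<Rightarrow> 4 \<Rightarrow> real" where
  "coframe_wedge a b p i j = coframe p $ a $ i * coframe p $ b $ j - coframe p $ b $ i * coframe p $ a $ j"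

definition ext_d1 :: "(real^4 \<Rightarrow> real^4) \<Rightarrow> real^4 \<Rightarrow> 4 \<Rightarrow> 4 \<Rightarrow> real" where
  "ext_d1 \<alpha> p i j = pd i (\<lambda>q. \<alpha> q $ j) p - pd j (\<lambda>q. \<alpha> q $ i) p"

lemma antisymmetric_4_eqI:
  fixes h k :: "4 \<Rightarrow> 4 \<Rightarrow> real"
  assumes "\<And>i j. h i j = - h j i" "\<And>i j. k i j = - k j i"
    and "h 1 2 = k 1 2" "h 1 3 = k 1 3" "h 1 4 = k 1 4" "h 2 3 = k 2 3" "h 2 4 = k 2 4" "h 3 4 = k 3 4"
  shows "\<forall>i j. h i j = k i j"
proof (intro allI)
  fix i j
  have "h i j - k i j = 0"
  proof (rule antisymmetric_4_zeroI[of "\<lambda>i j. h i j - k i j"])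
    show "h i j - k i j = - (h j i - k j i)" for i j
      using assms(1)[of i j] assms(2)[of i j] by simp
  qed (use assms(3-) in simp_all)
  then show "h i j = k i j" by simp
qed

text \<open>
  The second structure equation \<open>\<Omega> = d\<psi> + \<psi> \<and> \<psi>\<close>, entry by entry. The scalar part of the connection
  is closed and contributes nothing; the other coefficients turn out to depend on \<open>\<sigma>\<close> only.
\<close>

lemma structure_equations:
  shows "\<forall>i j. ext_d1 lform p i j = 0"
    and "\<forall>i j. ext_d1 aform p i j + 2 * (mform p $ i * nform p $ j - nform p $ i * mform p $ j) =
      - 4 * (\<rho> p)\<^sup>2 * coframe_wedge 1 2 p i j + (4 * (\<rho> p)\<^sup>2 - 2 * \<rho> p) * coframe_wedge 3 4 p i j"
    and "\<forall>i j. ext_d1 bform p i j - 2 * (mform p $ i * nform p $ j - nform p $ i * mform p $ j) =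
      (4 * (\<rho> p)\<^sup>2 - 2 * \<rho> p) * coframe_wedge 1 2 p i j + 4 * (\<rho> p - (\<rho> p)\<^sup>2) * coframe_wedge 3 4 p i j"
    and "\<forall>i j. ext_d1 mform p i j + ((bform p $ i - aform p $ i) * nform p $ j - nform p $ i * (bform p $ j - aform p $ j)) =
      (\<rho> p - 2 * (\<rho> p)\<^sup>2) * (coframe_wedge 1 3 p i j + coframe_wedge 2 4 p i j)"
    and "\<forall>i j. ext_d1 nform p i j + ((aform p $ i - bform p $ i) * mform p $ j - mform p $ i * (aform p $ j - bform p $ j)) =
      (\<rho> p - 2 * (\<rho> p)\<^sup>2) * (coframe_wedge 2 3 p i j - coframe_wedge 1 4 p i j)"
  by (rule antisymmetric_4_eqI;
      simp add: ext_d1_def coframe_wedge_def coframe_def lform_def aform_def bform_def mform_def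
        nform_def Let_def;
      (algebra | use \<rho>_rel[of p] in algebra)?)+

lemma curvature_form_eq:
  "instanton.curvature_form i j p = conformal_unitary 0
    (- 4 * (\<rho> p)\<^sup>2 * coframe_wedge 1 2 p i j + (4 * (\<rho> p)\<^sup>2 - 2 * \<rho> p) * coframe_wedge 3 4 p i j)
    ((4 * (\<rho> p)\<^sup>2 - 2 * \<rho> p) * coframe_wedge 1 2 p i j + 4 * (\<rho> p - (\<rho> p)\<^sup>2) * coframe_wedge 3 4 p i j)
    ((\<rho> p - 2 * (\<rho> p)\<^sup>2) * (coframe_wedge 1 3 p i j + coframe_wedge 2 4 p i j))
    ((\<rho> p - 2 * (\<rho> p)\<^sup>2) * (coframe_wedge 2 3 p i j - coframe_wedge 1 4 p i j))"
proof -
  have d: "lform differentiable (at p)" "aform differentiable (at p)" "bform differentiable (at p)"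
    "mform differentiable (at p)" "nform differentiable (at p)"
    by (simp_all add: smooth_on_differentiable[of UNIV] smooth_forms)
  have pd_connection: "pd i (connection j) p = conformal_unitary (pd i (\<lambda>q. lform q $ j) p) (pd i (\<lambda>q. aform q $ j) p)
    (pd i (\<lambda>q. bform q $ j) p) (pd i (\<lambda>q. mform q $ j) p) (pd i (\<lambda>q. nform q $ j) p)" for i j
    unfolding connection_def[abs_def] conformal_unitary_def
    by (simp add: d pd_bounded_linear[OF bounded_linear_scaleR_left] differentiable_bounded_linear[OF bounded_linear_scaleR_left])
  have "instanton.curvature_form i j p = conformal_unitary (ext_d1 lform p i j)
    (ext_d1 aform p i j + 2 * (mform p $ i * nform p $ j - nform p $ i * mform p $ j))
    (ext_d1 bform p i j - 2 * (mform p $ i * nform p $ j - nform p $ i * mform p $ j))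
    (ext_d1 mform p i j + ((bform p $ i - aform p $ i) * nform p $ j - nform p $ i * (bform p $ j - aform p $ j)))
    (ext_d1 nform p i j + ((aform p $ i - bform p $ i) * mform p $ j - mform p $ i * (aform p $ j - bform p $ j)))"
    unfolding instanton.curvature_form_def pd_connection unfolding connection_def
      conformal_unitary_diff conformal_unitary_commutator conformal_unitary_add ext_d1_def
    by (simp only: add_0_right diff_conv_add_uminus)
  then show ?thesis
    by (simp only: structure_equations[rule_format])
qed

section \<open>The Kaehler structure and the opposite Hermitian structure\<close>

definition J0 :: "real^4^4" where "J0 = conformal_unitary 0 1 1 0 0"
definition I0 :: "real^4^4" where "I0 = conformal_unitary 0 1 (- 1) 0 0"

lemma conformal_unitary_apply:
  "(conformal_unitary l a b m n *v x) $ 1 = l * x $ 1 - a * x $ 2 + m * x $ 3 - n * x $ 4"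
  "(conformal_unitary l a b m n *v x) $ 2 = l * x $ 2 + a * x $ 1 + m * x $ 4 + n * x $ 3"
  "(conformal_unitary l a b m n *v x) $ 3 = l * x $ 3 - b * x $ 4 - m * x $ 1 - n * x $ 2"
  "(conformal_unitary l a b m n *v x) $ 4 = l * x $ 4 + b * x $ 3 - m * x $ 2 + n * x $ 1"
  by (simp_all add: conformal_unitary_def KD_def KN_def KP_def KQ_def matrix4_simps matrix_vector_mult_def)

lemma metric_ip_frame: "metric_ip instanton_metric p X Y = \<sigma> p * ((coframe p *v X) \<bullet> (coframe p *v Y))"
proof -
  have "X \<bullet> (transpose (coframe p) *v w) = (coframe p *v X) \<bullet> w" for w
    using dot_lmul_matrix[of X "transpose (coframe p)" w] transpose_matrix_vector[of "transpose (coframe p)" X]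
    by simp
  then show ?thesis
    by (simp add: metric_ip_def instanton_metric_def scaleR_matrix_vector_assoc[symmetric]
        matrix_vector_mul_assoc[symmetric])
qed

lemma coframe_frame_apply [simp]: "coframe p *v (frame p *v x) = x"
  by (simp add: matrix_vector_mul_assoc coframe_frame)

lemma frame_coframe_apply [simp]: "frame p *v (coframe p *v x) = x"
  by (simp add: matrix_vector_mul_assoc instanton.frame_coframe)

lemma coframe_frame_endo [simp]: "coframe p *v (frame_endo K p *v X) = K *v (coframe p *v X)"
  by (simp add: frame_endo_def matrix_vector_mul_assoc[symmetric])

lemma coframe_inject: "coframe p *v X = coframe p *v Y \<longleftrightarrow> X = Y"
  by (metis frame_coframe_apply)

lemma smooth_metric: "open S \<Longrightarrow> smooth_on S instanton_metric"
  unfolding instanton_metric_def[abs_def]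
  by (intro smooth_on_bounded_bilinear[OF _ bounded_bilinear_scaleR] smooth_on_matrix_mult smooth_\<sigma>
      smooth_coframe smooth_on_bounded_linear[OF _ bounded_linear_transpose])

lemma smooth_frame_endo: "open S \<Longrightarrow> smooth_on S (frame_endo K)"
  unfolding frame_endo_def[abs_def]
  by (intro smooth_on_matrix_mult smooth_on_const smooth_frame smooth_coframe)

lemma almost_hermitian_frame_endo:
  assumes S: "open S" and K: "\<And>x. K *v (K *v x) = - x" "\<And>x y. (K *v x) \<bullet> (K *v y) = x \<bullet> y"
  shows "almost_hermitian_on S instanton_metric (frame_endo K)"
proof -
  have "metric_ip instanton_metric p X X > 0" if "X \<noteq> 0" for p X
    using that coframe_inject[of p X 0] by (simp add: metric_ip_frame)
  moreover have "frame_endo K p *v (frame_endo K p *v X) = - X" for p X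
  proof -
    have "coframe p *v (- X) = - (coframe p *v X)"
      using matrix_vector_mult_diff_distrib[of "coframe p" 0 X] by simp
    then show ?thesis
      by (subst coframe_inject[of p, symmetric]) (simp add: K)
  qed
  ultimately show ?thesis
    unfolding almost_hermitian_on_def riemannian_on_def
    using smooth_metric[OF S] smooth_frame_endo[OF S] S
    by (simp add: metric_ip_frame K inner_commute)
qed

lemma J0_apply: "(J0 *v x) $ 1 = - x $ 2" "(J0 *v x) $ 2 = x $ 1" "(J0 *v x) $ 3 = - x $ 4" "(J0 *v x) $ 4 = x $ 3"
  by (simp_all add: J0_def conformal_unitary_apply)

lemma I0_apply: "(I0 *v x) $ 1 = - x $ 2" "(I0 *v x) $ 2 = x $ 1" "(I0 *v x) $ 3 = x $ 4" "(I0 *v x) $ 4 = - x $ 3"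
  by (simp_all add: I0_def conformal_unitary_apply)

lemma J0_orthogonal: "J0 *v (J0 *v x) = - x" "(J0 *v x) \<bullet> (J0 *v y) = x \<bullet> y"
  by (simp_all add: vec_eq_iff forall_4 J0_apply inner_vec_def sum_4)

lemma I0_orthogonal: "I0 *v (I0 *v x) = - x" "(I0 *v x) \<bullet> (I0 *v y) = x \<bullet> y"
  by (simp_all add: vec_eq_iff forall_4 I0_apply inner_vec_def sum_4)

text \<open>\<open>J\<close> is complex scalar multiplication and commutes with \<open>u(2)\<close>, so it is parallel.\<close>

lemma commutator_J0: "connection i p ** J0 - J0 ** connection i p = 0"
  unfolding connection_def J0_def conformal_unitary_commutator by (simp add: conformal_unitary_def)

text \<open>The diagonal entries of the connection drop out; what remains of \<open>\<nabla>I\<close> is \<open>\<psi>\<^sub>1\<^sub>2\<close>.\<close>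

lemma commutator_I0: "connection i p ** I0 - I0 ** connection i p =
    conformal_unitary 0 0 0 (2 * nform p $ i) (- (2 * mform p $ i))"
  unfolding connection_def I0_def conformal_unitary_commutator by (simp add: mult.commute)

lemma hermitian_J: "open S \<Longrightarrow> hermitian_on S instanton_metric (frame_endo J0)"
  unfolding hermitian_on_def
  using almost_hermitian_frame_endo[OF _ J0_orthogonal]
    instanton.nijenhuis_frame_eq_0[of _ J0]
  by (simp add: commutator_J0 frame_endo_def[abs_def])

lemma sum_conformal_unitary:
  "(\<Sum>i\<in>A. c i *\<^sub>R conformal_unitary (l i) (a i) (b i) (m i) (n i)) =
    conformal_unitary (\<Sum>i\<in>A. c i * l i) (\<Sum>i\<in>A. c i * a i) (\<Sum>i\<in>A. c i * b i)
      (\<Sum>i\<in>A. c i * m i) (\<Sum>i\<in>A. c i * n i)"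
  by (simp add: conformal_unitary_def scaleR_add_right sum.distrib scaleR_left.sum)

lemma frame_endo_I0_rows:
  "frame_endo I0 p $ 3 $ i = (if i = 4 then 1 else 0)"
  "frame_endo I0 p $ 4 $ i = (if i = 3 then - 1 else 0)"
  using exhaust_4[of i]
  by (auto simp: frame_endo_def I0_def conformal_unitary_def KD_def KN_def frame_def coframe_def matrix4_simps)

text \<open>
  Since \<open>dy - i dt\<close> composed with \<open>I\<close> is \<open>i (dy - i dt)\<close>, the entry \<open>\<psi>\<^sub>1\<^sub>2\<close> gets multiplied by \<open>i\<close> when
  \<open>X\<close> is replaced by \<open>IX\<close>. This is \<open>\<nabla>\<^sub>I\<^sub>X I = I \<nabla>\<^sub>X I\<close>.
\<close>

lemma hermitian_I:
  assumes "open S"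
  shows "hermitian_on S instanton_metric (frame_endo I0)"
proof -
  have "(\<Sum>a\<in>UNIV. (frame p ** I0 ** coframe p) $ a $ i *\<^sub>R (connection a p ** I0 - I0 ** connection a p)) =
      I0 ** (connection i p ** I0 - I0 ** connection i p)" for i p
  proof -
    have "(\<Sum>a\<in>UNIV. (frame p ** I0 ** coframe p) $ a $ i *\<^sub>R (connection a p ** I0 - I0 ** connection a p)) =
      conformal_unitary 0 0 0 (2 * mform p $ i) (2 * nform p $ i)"
      unfolding commutator_I0 sum_conformal_unitary frame_endo_def[symmetric]
      using exhaust_4[of i] by (auto simp: sum_4 frame_endo_I0_rows mform_def nform_def)
    also have "\<dots> = I0 ** (connection i p ** I0 - I0 ** connection i p)"
      unfolding commutator_I0
      by (simp add: I0_def conformal_unitary_def KD_def KN_def KP_def KQ_def matrix4_simps)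
    finally show ?thesis .
  qed
  then have "nijenhuis (frame_endo I0) k i j p = 0" for k i j p
    using instanton.nijenhuis_frame_eq_0[of p I0 k i j] by (simp add: frame_endo_def[abs_def])
  then show ?thesis
    unfolding hermitian_on_def
    using almost_hermitian_frame_endo[OF assms I0_orthogonal] by simp
qed

lemma kahler_form_frame_endo:
  "kahler_form instanton_metric (frame_endo K) p = \<sigma> p *\<^sub>R (transpose (coframe p) ** transpose K ** coframe p)"
proof -
  have "transpose (frame p) ** transpose (coframe p) = mat 1"
    by (simp add: matrix_transpose_mul[symmetric] coframe_frame)
  then have "transpose (coframe p) ** transpose K ** (transpose (frame p) ** transpose (coframe p)) ** coframe p
    = transpose (coframe p) ** transpose K ** coframe p"
    by simp
  then show ?thesis
    by (simp add: kahler_form_def frame_endo_def instanton_metric_def matrix_transpose_mul matrix_mul_assoc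
        matrix_mult_bilinear)
qed

lemma \<sigma>_\<rho>_rels: "\<sigma> p = 1 + (p $ 1)\<^sup>2 + (p $ 2)\<^sup>2" "\<sigma> p * \<rho> p = 1"
  by (simp_all add: \<sigma>_def[symmetric])

lemma kahler_form_J:
  "kahler_form instanton_metric (frame_endo J0) p =
     vector [vector [0, 1, 0, 2 * p $ 3 * p $ 1],
             vector [- 1, 0, 0, 2 * p $ 3 * p $ 2],
             vector [0, 0, 0, \<sigma> p],
             vector [- (2 * p $ 3 * p $ 1), - (2 * p $ 3 * p $ 2), - \<sigma> p, 0]]"
  unfolding kahler_form_frame_endo
  by (simp add: J0_def conformal_unitary_def KD_def KN_def coframe_def matrix4_simps;
      intro conjI; (algebra | use \<sigma>_\<rho>_rels[of p] in algebra))

lemma kahler_form_I: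
  "kahler_form instanton_metric (frame_endo I0) p =
     vector [vector [0, 1, 0, 2 * p $ 3 * p $ 1],
             vector [- 1, 0, 0, 2 * p $ 3 * p $ 2],
             vector [0, 0, 0, - \<sigma> p],
             vector [- (2 * p $ 3 * p $ 1), - (2 * p $ 3 * p $ 2), \<sigma> p, 0]]"
  unfolding kahler_form_frame_endo
  by (simp add: I0_def conformal_unitary_def KD_def KN_def coframe_def matrix4_simps;
      intro conjI; (algebra | use \<sigma>_\<rho>_rels[of p] in algebra))

lemma kahler_J: "open S \<Longrightarrow> kahler_on S instanton_metric (frame_endo J0)"
proof -
  have "\<forall>i j k. ext_d2 (kahler_form instanton_metric (frame_endo J0)) i j k p = 0" for p
    unfolding forall_4 by (simp add: ext_d2_def kahler_form_J)
  then show "open S \<Longrightarrow> kahler_on S instanton_metric (frame_endo J0)"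
    by (simp add: kahler_on_def hermitian_J)
qed

text \<open>
  The Kaehler form of \<open>I\<close> differs from the closed form \<open>\<omega>\<^sub>J\<close> by \<open>-2 \<sigma> dy \<and> dt\<close>. Hence
  \<open>d\<omega>\<^sub>I = -2 d\<sigma> \<and> dy \<and> dt = 2 d(log \<sigma>) \<and> \<omega>\<^sub>I\<close>, and \<open>2 lform = d(log \<sigma>)\<close>.
\<close>

lemma lee_form_I: "open S \<Longrightarrow> lee_form_on S instanton_metric (frame_endo I0) (\<lambda>p. 2 *\<^sub>R lform p)"
proof -
  have "\<forall>i j k. ext_d2 (kahler_form instanton_metric (frame_endo I0)) i j k p =
      2 * wedge12 (\<lambda>p. 2 *\<^sub>R lform p) (kahler_form instanton_metric (frame_endo I0)) i j k p" for p
    unfolding forall_4 by (simp add: ext_d2_def wedge12_def kahler_form_I lform_def \<rho>_def)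
  then show "open S \<Longrightarrow> lee_form_on S instanton_metric (frame_endo I0) (\<lambda>p. 2 *\<^sub>R lform p)"
    unfolding lee_form_on_def
    by (simp add: smooth_on_bounded_linear[OF _ bounded_linear_scaleR_right] smooth_forms)
qed

text \<open>The Lee form is \<open>d(log \<sigma>)\<close>, so it is cancelled by rescaling the metric with \<open>\<sigma>\<close> to the power \<open>-2\<close>.\<close>

lemma kahler_conformal_I:
  assumes S: "open S"
  shows "kahler_on S (\<lambda>q. (\<rho> q)\<^sup>2 *\<^sub>R instanton_metric q) (frame_endo I0)"
proof -
  have ip: "metric_ip (\<lambda>q. (\<rho> q)\<^sup>2 *\<^sub>R instanton_metric q) p X Y =
      (\<rho> p)\<^sup>2 * metric_ip instanton_metric p X Y" for p X Y
    by (simp add: metric_ip_def scaleR_matrix_vector_assoc[symmetric])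
  have "smooth_on S (\<lambda>q. (\<rho> q)\<^sup>2 *\<^sub>R instanton_metric q)"
    by (intro smooth_on_bounded_bilinear[OF S bounded_bilinear_scaleR] smooth_on_power2 S smooth_\<rho> smooth_metric)
  then have "hermitian_on S (\<lambda>q. (\<rho> q)\<^sup>2 *\<^sub>R instanton_metric q) (frame_endo I0)"
    using hermitian_I[OF S]
    by (simp add: hermitian_on_def almost_hermitian_on_def riemannian_on_def ip)
  moreover have "kahler_form (\<lambda>q. (\<rho> q)\<^sup>2 *\<^sub>R instanton_metric q) (frame_endo I0) =
      (\<lambda>q. (\<rho> q)\<^sup>2 *\<^sub>R kahler_form instanton_metric (frame_endo I0) q)"
    by (simp add: fun_eq_iff kahler_form_def matrix_mult_bilinear)
  moreover have "\<forall>i j k.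
      ext_d2 (\<lambda>q. (\<rho> q)\<^sup>2 *\<^sub>R kahler_form instanton_metric (frame_endo I0) q) i j k p = 0" for p
    unfolding forall_4 by (simp add: ext_d2_def kahler_form_I)
  ultimately show ?thesis
    by (simp add: kahler_on_def)
qed

lemma lck_I:
  assumes "open S"
  shows "lck_on S instanton_metric (frame_endo I0)"
  unfolding lck_on_def
  using assms hermitian_I kahler_conformal_I[OF assms] smooth_on_power2[OF assms smooth_\<rho>[OF assms]]
  by (auto intro!: exI[of _ S] exI[of _ "\<lambda>q. (\<rho> q)\<^sup>2"])

section \<open>The vertical distribution and the holomorphic curvature\<close>

lemma coframe_wedge_apply:
  "(\<Sum>i\<in>UNIV. \<Sum>j\<in>UNIV. (X $ i * Y $ j) * coframe_wedge a b p i j) =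
    (coframe p *v X) $ a * (coframe p *v Y) $ b - (coframe p *v X) $ b * (coframe p *v Y) $ a"
  unfolding coframe_wedge_def right_diff_distrib sum_subtractf matrix_vector_mult_def
  by (simp add: sum_product mult_ac)

lemma curvature_apply:
  fixes X Y p :: "real^4"
  defines "w \<equiv> \<lambda>a b. (coframe p *v X) $ a * (coframe p *v Y) $ b - (coframe p *v X) $ b * (coframe p *v Y) $ a"
  shows "(\<Sum>i\<in>UNIV. \<Sum>j\<in>UNIV. (X $ i * Y $ j) *\<^sub>R instanton.curvature_form i j p) = conformal_unitary 0
    (- 4 * (\<rho> p)\<^sup>2 * w 1 2 + (4 * (\<rho> p)\<^sup>2 - 2 * \<rho> p) * w 3 4)
    ((4 * (\<rho> p)\<^sup>2 - 2 * \<rho> p) * w 1 2 + 4 * (\<rho> p - (\<rho> p)\<^sup>2) * w 3 4)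
    ((\<rho> p - 2 * (\<rho> p)\<^sup>2) * (w 1 3 + w 2 4))
    ((\<rho> p - 2 * (\<rho> p)\<^sup>2) * (w 2 3 - w 1 4))"
proof -
  have lin: "(\<Sum>i\<in>UNIV. \<Sum>j\<in>UNIV. (X $ i * Y $ j) * (c * h i j)) =
      c * (\<Sum>i\<in>UNIV. \<Sum>j\<in>UNIV. (X $ i * Y $ j) * h i j)" for c and h :: "4 \<Rightarrow> 4 \<Rightarrow> real"
    by (simp add: sum_distrib_left mult_ac)
  have sum1: "(\<Sum>i\<in>A. conformal_unitary (l i) (a i) (b i) (m i) (n i)) =
    conformal_unitary (\<Sum>i\<in>A. l i) (\<Sum>i\<in>A. a i) (\<Sum>i\<in>A. b i) (\<Sum>i\<in>A. m i) (\<Sum>i\<in>A. n i)"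
    for A :: "4 set" and l a b m n
    using sum_conformal_unitary[of "\<lambda>_. 1"] by simp
  show ?thesis
    unfolding curvature_form_eq sum_conformal_unitary sum1
    by (simp only: distrib_left right_diff_distrib sum.distrib sum_subtractf)
      (simp only: lin coframe_wedge_apply w_def mult_zero_right sum.neutral_const distrib_left right_diff_distrib)
qed

text \<open>
  The off-diagonal part of the curvature enters through
  \<open>(\<xi>\<^sub>2 \<xi>\<^sub>3 - \<xi>\<^sub>1 \<xi>\<^sub>4)\<^sup>2 + (\<xi>\<^sub>1 \<xi>\<^sub>3 + \<xi>\<^sub>2 \<xi>\<^sub>4)\<^sup>2 = |\<theta>(X)|\<^sup>2 |\<beta>(X)|\<^sup>2\<close>, where \<open>\<xi>\<close> are the frame
  components of \<open>X\<close>. This is why only the two lengths survive.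
\<close>

lemma hol_curv_frame:
  fixes X p :: "real^4"
  defines "t \<equiv> ((coframe p *v X) $ 1)\<^sup>2 + ((coframe p *v X) $ 2)\<^sup>2"
    and "t' \<equiv> ((coframe p *v X) $ 3)\<^sup>2 + ((coframe p *v X) $ 4)\<^sup>2"
  shows "hol_curv instanton_metric (frame_endo J0) p X =
    \<sigma> p * (4 * (\<rho> p)\<^sup>2 * t\<^sup>2 + (8 * \<rho> p - 16 * (\<rho> p)\<^sup>2) * t * t' - 4 * (\<rho> p - (\<rho> p)\<^sup>2) * t'\<^sup>2)"
  unfolding hol_curv_def instanton.riem_frame[OF UNIV_I] curvature_apply t_def t'_def
  by (simp add: inner_vec_def sum_4 conformal_unitary_apply J0_apply) algebra

definition vertical :: "real^4 \<Rightarrow> (real^4) set" where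
  "vertical p = {X. X $ 3 = 0 \<and> X $ 4 = 0}"

lemma coframe_3_4 [simp]: "(coframe p *v X) $ 3 = X $ 3" "(coframe p *v X) $ 4 = X $ 4"
  by (simp_all add: coframe_def matrix_vector_mult_def sum_4 Let_def)

lemma frame_3_4 [simp]: "(frame p *v X) $ 3 = X $ 3" "(frame p *v X) $ 4 = X $ 4"
  by (simp_all add: frame_def matrix_vector_mult_def sum_4 Let_def)

lemma perp_vertical:
  "perp instanton_metric vertical p = {X. (coframe p *v X) $ 1 = 0 \<and> (coframe p *v X) $ 2 = 0}"
proof (intro set_eqI iffI)
  fix X assume "X \<in> perp instanton_metric vertical p"
  then have *: "metric_ip instanton_metric p X (frame p *v axis a 1) = 0" if "a = 1 \<or> a = 2" for a
    using that by (auto simp: perp_def vertical_def axis_def)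
  from *[of 1] *[of 2] show "X \<in> {X. (coframe p *v X) $ 1 = 0 \<and> (coframe p *v X) $ 2 = 0}"
    by (simp add: metric_ip_frame inner_axis)
qed (simp add: perp_def vertical_def metric_ip_frame inner_vec_def sum_4)

lemma orth_proj_vertical:
  fixes X :: "real^4"
  shows "orth_proj instanton_metric vertical p X =
    frame p *v vector [(coframe p *v X) $ 1, (coframe p *v X) $ 2, 0, 0]" (is "_ = ?Y")
  unfolding orth_proj_def
proof (rule the_equality)
  show "?Y \<in> vertical p \<and> X - ?Y \<in> perp instanton_metric vertical p"
    by (simp add: perp_vertical matrix_vector_mult_diff_distrib) (simp add: vertical_def)
  fix Y assume "Y \<in> vertical p \<and> X - Y \<in> perp instanton_metric vertical p"
  then have "coframe p *v Y = coframe p *v ?Y"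
    by (simp add: perp_vertical matrix_vector_mult_diff_distrib vec_eq_iff[where ?'a=real] forall_4)
      (simp add: vertical_def)
  then show "Y = ?Y" by (simp only: coframe_inject)
qed

lemma vertical_span: "vertical p = span {axis 1 1, axis 2 1}"
proof
  show "vertical p \<subseteq> span {axis 1 1, axis 2 1}"
  proof
    fix X assume "X \<in> vertical p"
    then have *: "X = X $ 1 *\<^sub>R axis 1 1 + X $ 2 *\<^sub>R axis 2 1"
      by (simp add: vertical_def vec_eq_iff forall_4 axis_def)
    then show "X \<in> span {axis 1 1, axis 2 1}"
      by (subst *) (intro span_add span_scale span_base; simp)
  qed
  show "span {axis 1 1, axis 2 1} \<subseteq> vertical p"
    by (rule span_minimal) (auto simp: vertical_def subspace_def axis_def)
qed

lemma distribution_vertical: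
  assumes "open S"
  shows "distribution2_on S vertical"
  unfolding distribution2_on_def
proof (intro conjI ballI)
  fix p assume "p \<in> S"
  have "independent {axis 1 1, axis 2 1 :: real^4}"
    by (rule independent_mono[OF independent_Basis]) (auto simp: axis_in_Basis_iff)
  then show "dim (vertical p) = 2"
    unfolding vertical_span by (simp add: dim_eq_card_independent axis_eq_axis)
  show "subspace (vertical p)"
    unfolding vertical_span by (rule subspace_span)
  show "\<exists>V X Y. open V \<and> p \<in> V \<and> V \<subseteq> S \<and> smooth_on V X \<and> smooth_on V Y \<and>
      (\<forall>q\<in>V. vertical q = span {X q, Y q})"
    using assms \<open>p \<in> S\<close> vertical_span smooth_on_const
    by (intro exI[of _ S] exI[of _ "\<lambda>_. axis 1 1"] exI[of _ "\<lambda>_. axis 2 1"]) auto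
qed

text \<open>
  For a unit vector \<open>\<sigma> (|\<theta>(X)|\<^sup>2 + |\<beta>(X)|\<^sup>2) = 1\<close> and \<open>|X\<^sub>D|\<^sup>2 = \<sigma> |\<theta>(X)|\<^sup>2\<close>, so \<open>|X\<^sub>D|\<close> determines both
  lengths in the formula for the holomorphic curvature.
\<close>

lemma qch_kahler:
  assumes "open S"
  shows "qch_kahler_on S instanton_metric (frame_endo J0) vertical"
proof -
  define \<phi> where "\<phi> p r = \<rho> p * (4 * (\<rho> p)\<^sup>2 * (r\<^sup>2)\<^sup>2 + (8 * \<rho> p - 16 * (\<rho> p)\<^sup>2) * r\<^sup>2 * (1 - r\<^sup>2)
    - 4 * (\<rho> p - (\<rho> p)\<^sup>2) * (1 - r\<^sup>2)\<^sup>2)" for p r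
  have "hol_curv instanton_metric (frame_endo J0) p X =
      \<phi> p (metric_norm instanton_metric p (orth_proj instanton_metric vertical p X))"
    if "metric_ip instanton_metric p X X = 1" for p X
  proof -
    define t where "t = ((coframe p *v X) $ 1)\<^sup>2 + ((coframe p *v X) $ 2)\<^sup>2"
    define t' where "t' = ((coframe p *v X) $ 3)\<^sup>2 + ((coframe p *v X) $ 4)\<^sup>2"
    have unit: "\<sigma> p * (t + t') = 1"
      using that by (simp add: metric_ip_frame inner_vec_def sum_4 t_def t'_def power2_eq_square add.assoc)
    have norm: "(metric_norm instanton_metric p (orth_proj instanton_metric vertical p X))\<^sup>2 = \<sigma> p * t"
      using less_imp_le[OF \<sigma>_pos(1)[of p]]
      by (simp add: metric_norm_def metric_ip_frame orth_proj_vertical inner_vec_def sum_4 t_def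
          power2_eq_square[symmetric])
    have t: "t = \<rho> p * (\<sigma> p * t)" "t' = \<rho> p * (1 - \<sigma> p * t)"
      using unit \<sigma>_\<rho>_rels(2)[of p] by algebra+
    show ?thesis
      unfolding hol_curv_frame t_def[symmetric] t'_def[symmetric] \<phi>_def norm
      using unit \<sigma>_\<rho>_rels(2)[of p] t by algebra
  qed
  moreover have "frame_endo J0 p *v X \<in> vertical p" if "X \<in> vertical p" for p X
    using that coframe_3_4[of p "frame_endo J0 p *v X", unfolded coframe_frame_endo J0_apply coframe_3_4]
    by (simp add: vertical_def)
  ultimately show ?thesis
    unfolding qch_kahler_on_def
    using kahler_J[OF assms] distribution_vertical[OF assms] by blast
qed

section \<open>Calabi type away from the fixed points of the rotation\<close>

definition regular_locus :: "(real^4) set" where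
  "regular_locus = {p. p $ 1 \<noteq> 0 \<or> p $ 2 \<noteq> 0}"

lemma open_regular_locus: "open regular_locus"
  unfolding regular_locus_def
  by (intro open_Collect_disj open_Collect_neq continuous_intros)

lemma closure_regular_locus: "closure regular_locus = UNIV"
proof -
  have "p \<in> closure regular_locus" for p
  proof (cases "p \<in> regular_locus")
    case False
    have "p + e *\<^sub>R axis 1 1 \<in> regular_locus" if "e \<noteq> 0" for e
      using False that by (auto simp: regular_locus_def axis_def)
    moreover have "dist (p + (e / 2) *\<^sub>R axis 1 1) p < e" if "e > 0" for e
      using that by (simp add: dist_norm)
    ultimately show ?thesis
      unfolding closure_approachable by (metis half_gt_zero less_numeral_extra(3))
  qed (use closure_subset in blast)
  then show ?thesis by blast
qed

lemma opposite_I: "opposite_on S instanton_metric (frame_endo J0) vertical (frame_endo I0)"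
proof -
  have "frame_endo I0 p *v X = frame_endo J0 p *v X" if "X \<in> vertical p" for p X
  proof -
    have "I0 *v (coframe p *v X) = J0 *v (coframe p *v X)"
      using that by (simp add: vec_eq_iff forall_4 I0_apply J0_apply vertical_def)
    then show ?thesis
      by (subst coframe_inject[of p, symmetric]) simp
  qed
  moreover have "frame_endo I0 p *v X = - (frame_endo J0 p *v X)"
    if "X \<in> perp instanton_metric vertical p" for p X
  proof -
    have "I0 *v (coframe p *v X) = - (J0 *v (coframe p *v X))"
      using that by (simp add: vec_eq_iff forall_4 I0_apply J0_apply perp_vertical)
    moreover have "coframe p *v (- Y) = - (coframe p *v Y)" for Y
      using matrix_vector_mult_diff_distrib[of "coframe p" 0 Y] by simp
    ultimately show ?thesis
      by (subst coframe_inject[of p, symmetric]) simp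
  qed
  ultimately show ?thesis
    by (simp add: opposite_on_def)
qed

text \<open>
  \<open>\<nabla>\<^sub>X I\<close> vanishes with \<open>\<psi>\<^sub>1\<^sub>2(X) = - (z / \<sigma>) (X\<^sub>3 - i X\<^sub>4)\<close>, and \<open>z \<noteq> 0\<close> on the regular locus.
\<close>

lemma nullity_I:
  assumes "p \<in> regular_locus"
  shows "nullity instanton_metric (frame_endo I0) p = vertical p"
proof -
  define C where "C X = conformal_unitary 0 0 0 (2 * (X \<bullet> nform p)) (- (2 * (X \<bullet> mform p)))" for X
  have cov: "cov_endo instanton_metric (frame_endo I0) p X = frame p ** C X ** coframe p" for X
  proof -
    have "frame p ** C X ** coframe p =
        (\<Sum>i\<in>UNIV. X $ i *\<^sub>R (frame p ** (connection i p ** I0 - I0 ** connection i p) ** coframe p))"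
    proof -
      have "C X = (\<Sum>i\<in>UNIV. X $ i *\<^sub>R (connection i p ** I0 - I0 ** connection i p))"
        unfolding commutator_I0 sum_conformal_unitary
        by (simp add: C_def inner_vec_def sum_distrib_left sum_negf mult_ac)
      then show ?thesis by (simp add: matrix_mult_bilinear)
    qed
    then show ?thesis
      by (simp add: vec_eq_iff[where ?'b="4"] cov_endo_def frame_endo_def[abs_def] instanton.cov_endo_coeff_frame)
  qed
  have "cov_endo instanton_metric (frame_endo I0) p X = 0 \<longleftrightarrow> C X = 0" for X
  proof
    assume "cov_endo instanton_metric (frame_endo I0) p X = 0"
    then have "coframe p ** (frame p ** C X ** coframe p) ** frame p = 0"
      by (simp add: cov)
    moreover have "coframe p ** (frame p ** C X ** coframe p) ** frame p =
        (coframe p ** frame p) ** C X ** (coframe p ** frame p)"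
      by (simp only: matrix_mul_assoc)
    ultimately show "C X = 0" by (simp add: coframe_frame)
  qed (simp add: cov)
  also have "C X = 0 \<longleftrightarrow> X \<bullet> nform p = 0 \<and> X \<bullet> mform p = 0" for X
    by (auto simp: C_def conformal_unitary_def KP_def KQ_def vec_eq_iff forall_4)
  also have "X \<bullet> nform p = 0 \<and> X \<bullet> mform p = 0 \<longleftrightarrow> X $ 3 = 0 \<and> X $ 4 = 0" for X
  proof
    assume *: "X \<bullet> nform p = 0 \<and> X \<bullet> mform p = 0"
    have "X \<bullet> nform p = \<rho> p * (X $ 4 * p $ 1 - X $ 3 * p $ 2)"
      "X \<bullet> mform p = - \<rho> p * (X $ 3 * p $ 1 + X $ 4 * p $ 2)"
      by (simp_all add: inner_vec_def sum_4 nform_def mform_def algebra_simps)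
    then have "X $ 4 * p $ 1 - X $ 3 * p $ 2 = 0" "X $ 3 * p $ 1 + X $ 4 * p $ 2 = 0"
      using * by simp_all
    then have "X $ 3 * ((p $ 1)\<^sup>2 + (p $ 2)\<^sup>2) = 0" "X $ 4 * ((p $ 1)\<^sup>2 + (p $ 2)\<^sup>2) = 0"
      by algebra+
    then show "X $ 3 = 0 \<and> X $ 4 = 0"
      using assms by (auto simp: regular_locus_def)
  qed (simp add: inner_vec_def sum_4 nform_def mform_def)
  finally show ?thesis
    by (auto simp: nullity_def vertical_def)
qed

text \<open>The squared norm is a multiple of \<open>|\<psi>\<^sub>1\<^sub>2|\<^sup>2\<close>, hence of \<open>|z|\<^sup>2\<close>.\<close>

lemma cov_endo_norm_I: "cov_endo_norm instanton_metric (frame_endo I0) p =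
  sqrt (32 * (\<rho> p)\<^sup>2 * ((p $ 1)\<^sup>2 + (p $ 2)\<^sup>2) / \<sigma> p)"
  unfolding frame_endo_def[abs_def] instanton.cov_endo_norm_frame[OF UNIV_I] commutator_I0
  by (simp add: sum_4 conformal_unitary_def KP_def KQ_def frame_def nform_def mform_def Let_def
    power_mult_distrib algebra_simps)

text \<open>
  The Lee field is a multiple of the radial field \<open>u \<partial>\<^sub>u + v \<partial>\<^sub>v\<close> and its \<open>I\<close>-image one of the
  rotation field \<open>u \<partial>\<^sub>v - v \<partial>\<^sub>u\<close>; they span the fibre direction wherever \<open>z \<noteq> 0\<close>.
\<close>

lemma sharp_lee: "sharp instanton_metric (\<lambda>p. 2 *\<^sub>R lform p) p =
  (2 * (\<rho> p)\<^sup>2) *\<^sub>R vector [p $ 1, p $ 2, 0, 0]"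
proof -
  have "frame p *v (transpose (frame p) *v lform p) = \<rho> p *\<^sub>R vector [p $ 1, p $ 2, 0, 0]"
    by (simp add: frame_def lform_def matrix_vector_mult_def transpose_def vec_eq_iff forall_4 sum_4 Let_def)
      (intro conjI; algebra)
  then show ?thesis
    unfolding sharp_def instanton.metric_inverse[OF UNIV_I]
    by (simp add: \<rho>_def scaleR_matrix_vector_assoc[symmetric] matrix_vector_mult_scaleR
      matrix_vector_mul_assoc[symmetric] power2_eq_square)
qed

lemma span_radial_angular:
  fixes u v a b :: real
  assumes "a \<noteq> 0" "b \<noteq> 0" "u \<noteq> 0 \<or> v \<noteq> 0"
  shows "span {a *\<^sub>R vector [u, v, 0, 0], b *\<^sub>R vector [- v, u, 0, 0]} = vertical p"
proof
  show "span {a *\<^sub>R vector [u, v, 0, 0], b *\<^sub>R vector [- v, u, 0, 0]} \<subseteq> vertical p"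
    by (rule span_minimal; auto simp: vertical_def subspace_def)
  show "vertical p \<subseteq> span {a *\<^sub>R vector [u, v, 0, 0], b *\<^sub>R vector [- v, u, 0, 0]}"
  proof
    fix X assume X: "X \<in> vertical p"
    define r where "r = u\<^sup>2 + v\<^sup>2"
    have r: "r \<noteq> 0" using assms(3) by (auto simp: r_def)
    have "X = ((X $ 1 * u + X $ 2 * v) / (a * r)) *\<^sub>R (a *\<^sub>R vector [u, v, 0, 0])
        + ((X $ 2 * u - X $ 1 * v) / (b * r)) *\<^sub>R (b *\<^sub>R vector [- v, u, 0, 0])"
      using X assms(1,2) r
      by (simp add: vertical_def vec_eq_iff forall_4 field_simps) (simp add: r_def power2_eq_square algebra_simps)
    also have "\<dots> \<in> span {a *\<^sub>R vector [u, v, 0, 0], b *\<^sub>R vector [- v, u, 0, 0]}"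
      by (intro span_add span_scale span_base) auto
    finally show "X \<in> span {a *\<^sub>R vector [u, v, 0, 0], b *\<^sub>R vector [- v, u, 0, 0]}" .
  qed
qed

lemma I_sharp_lee: "frame_endo I0 p *v sharp instanton_metric (\<lambda>p. 2 *\<^sub>R lform p) p =
  (2 * \<rho> p) *\<^sub>R vector [- p $ 2, p $ 1, 0, 0]"
proof -
  have "coframe p *v (frame_endo I0 p *v sharp instanton_metric (\<lambda>p. 2 *\<^sub>R lform p) p) =
    coframe p *v ((2 * \<rho> p) *\<^sub>R vector [- p $ 2, p $ 1, 0, 0])"
    unfolding coframe_frame_endo sharp_lee
    by (simp add: vec_eq_iff[where 'b=4] forall_4 I0_apply)
      (simp add: coframe_def matrix_vector_mult_def sum_4 Let_def; intro conjI; use \<rho>_rel[of p] in algebra)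
  then show ?thesis by (simp only: coframe_inject)
qed

lemma generalized_calabi:
  "generalized_calabi_on regular_locus instanton_metric (frame_endo J0) vertical (frame_endo I0)"
proof -
  have span: "span {sharp instanton_metric (\<lambda>p. 2 *\<^sub>R lform p) p,
      frame_endo I0 p *v sharp instanton_metric (\<lambda>p. 2 *\<^sub>R lform p) p} = vertical p"
    if "p \<in> regular_locus" for p
    unfolding I_sharp_lee unfolding sharp_lee
    using that by (intro span_radial_angular) (auto simp: regular_locus_def)
  have "cov_endo_norm instanton_metric (frame_endo I0) p > 0" if "p \<in> regular_locus" for p
  proof -
    have "(p $ 1)\<^sup>2 + (p $ 2)\<^sup>2 > 0"
      using that by (auto simp: regular_locus_def sum_power2_gt_zero_iff)
    then show ?thesis by (simp add: cov_endo_norm_I)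
  qed
  then show ?thesis
    unfolding generalized_calabi_on_def
    using qch_kahler[OF open_regular_locus] opposite_I hermitian_I[OF open_regular_locus]
      lee_form_I[OF open_regular_locus] span nullity_I
    by (intro conjI exI[of _ "\<lambda>p. 2 *\<^sub>R lform p"]) auto
qed

lemma calabi_type: "qch_kahler_calabi_type_on UNIV instanton_metric (frame_endo J0)"
  unfolding qch_kahler_calabi_type_on_def calabi_on_def
  using qch_kahler[OF open_UNIV] open_regular_locus closure_regular_locus generalized_calabi
    lck_I[OF open_regular_locus]
  by blast

section \<open>Comparison with the adapted coordinates\<close>

definition cart_jacobian :: "real^4 \<Rightarrow> real^4^4" where
  "cart_jacobian q = vector [vector [cos (q $ 3), 0, - (q $ 1 * sin (q $ 3)), 0],
                   vector [sin (q $ 3), 0, q $ 1 * cos (q $ 3), 0],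
                   vector [0, 1, 0, 0],
                   vector [0, 0, 0, 1]]"

lemma jacobian_cart: "jacobian cart (at q) = cart_jacobian q"
proof -
  have "(cart has_derivative (\<lambda>h. cart_jacobian q *v h)) (at q)"
  proof -
    have "((\<lambda>q. (q $ 1 * cos (q $ 3)) *\<^sub>R axis 1 1 + (q $ 1 * sin (q $ 3)) *\<^sub>R axis 2 1
        + q $ 2 *\<^sub>R axis 3 1 + q $ 4 *\<^sub>R axis 4 1) has_derivative (\<lambda>h. cart_jacobian q *v h)) (at q)"
      by (rule derivative_eq_intros refl bounded_linear.has_derivative[OF bounded_linear_vec_nth])+
        (auto simp: fun_eq_iff vec_eq_iff forall_4 axis_def cart_jacobian_def matrix_vector_mult_def sum_4 algebra_simps)
    moreover have "cart = (\<lambda>q. (q $ 1 * cos (q $ 3)) *\<^sub>R axis 1 1 + (q $ 1 * sin (q $ 3)) *\<^sub>R axis 2 1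
        + q $ 2 *\<^sub>R axis 3 1 + q $ 4 *\<^sub>R axis 4 1)"
      by (auto simp: fun_eq_iff vec_eq_iff forall_4 axis_def cart_def)
    ultimately show ?thesis by simp
  qed
  then show ?thesis
    unfolding jacobian_def using frechet_derivative_at[of cart] by (metis matrix_of_matrix_vector_mul)
qed

lemma pullback_metric: "pullback cart instanton_metric q = adapted_metric q"
proof -
  define x y c s r where "x = q $ 1" "y = q $ 2" "c = cos (q $ 3)" "s = sin (q $ 3)" "r = \<rho> (cart q)"
  note abbr = this
  have cs: "c\<^sup>2 + s\<^sup>2 = 1" by (simp add: abbr)
  have \<sigma>: "\<sigma> (cart q) = 1 + x\<^sup>2"
    using cs by (simp add: \<sigma>_def cart_def abbr[symmetric] power_mult_distrib distrib_left[symmetric] add.assoc)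
  have r: "r * (1 + x\<^sup>2) = 1"
    using \<sigma> \<rho>_\<sigma>[of "cart q"] by (simp add: abbr(5))
  have cart: "cart q $ 1 = x * c" "cart q $ 2 = x * s" "cart q $ 3 = y"
    by (simp_all add: cart_def abbr)
  \<comment> \<open>\<open>\<theta>\<close> becomes \<open>exp(i\<theta>\<^sub>1) (dx + i (x / \<sigma>) (d\<theta>\<^sub>1 + 2y d\<theta>\<^sub>2))\<close>\<close>
  have EJ: "coframe (cart q) ** cart_jacobian q =
    vector [vector [c, 0, - (r * x * s), - (2 * r * x * y * s)],
            vector [s, 0, r * x * c, 2 * r * x * y * c],
            vector [0, 1, 0, 0],
            vector [0, 0, 0, 1]]"
    by (simp add: coframe_def cart_jacobian_def cart matrix4_simps abbr[symmetric]; (intro conjI)?;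
       ((algebra | use cs r in algebra))?)
  have pb: "pullback cart instanton_metric q =
    (1 + x\<^sup>2) *\<^sub>R (transpose (coframe (cart q) ** cart_jacobian q) ** (coframe (cart q) ** cart_jacobian q))"
    by (simp add: pullback_def jacobian_cart instanton_metric_def \<sigma> matrix_transpose_mul matrix_mul_assoc
        matrix_mult_bilinear)
  have inv: "inverse (1 + x\<^sup>2) = r"
    using r by (metis inverse_unique mult.commute)
  show ?thesis
    unfolding pb EJ adapted_metric_def Let_def abbr(1,2)[symmetric] divide_inverse inv
    by (simp add: matrix4_simps, intro conjI; (algebra | use cs r in algebra)?)
qed

lemma pullback_form: "pullback cart (kahler_form instanton_metric (frame_endo J0)) q = adapted_form q"
proof -
  define x y c s where "x = q $ 1" "y = q $ 2" "c = cos (q $ 3)" "s = sin (q $ 3)"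
  note abbr = this
  have cs: "c\<^sup>2 + s\<^sup>2 = 1" by (simp add: abbr)
  have \<sigma>: "\<sigma> (cart q) = 1 + x\<^sup>2"
    using cs by (simp add: \<sigma>_def cart_def abbr[symmetric] power_mult_distrib distrib_left[symmetric] add.assoc)
  show ?thesis
    unfolding pullback_def jacobian_cart kahler_form_J \<sigma>
    by (simp add: adapted_form_def cart_jacobian_def cart_def matrix4_simps abbr[symmetric]; intro conjI;
       (algebra | use cs in algebra))
qed

lemma instanton_structure: "exceptional_half_plane_instanton instanton_metric (frame_endo J0)"
  unfolding exceptional_half_plane_instanton_def
  by (simp add: smooth_metric smooth_frame_endo pullback_metric pullback_form)

lemma cart_surj_regular_locus:
  assumes "p \<in> regular_locus"
  obtains q where "q \<in> adapted_domain" "cart q = p"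
proof -
  define x where "x = sqrt ((p $ 1)\<^sup>2 + (p $ 2)\<^sup>2)"
  have x: "x > 0" "x\<^sup>2 = (p $ 1)\<^sup>2 + (p $ 2)\<^sup>2"
    using assms by (auto simp: x_def regular_locus_def sum_power2_gt_zero_iff)
  have "(p $ 1 / x)\<^sup>2 + (p $ 2 / x)\<^sup>2 = 1"
    unfolding power_divide add_divide_distrib[symmetric] x(2)[symmetric] using x(1) by simp
  then obtain t where "p $ 1 / x = cos t" "p $ 2 / x = sin t"
    using sincos_total_2pi by metis
  then have "cart (vector [x, p $ 3, t, p $ 4]) = p"
    using x(1) by (simp add: cart_def vec_eq_iff forall_4 field_simps)
  moreover have "vector [x, p $ 3, t, p $ 4] \<in> adapted_domain"
    using x(1) by (simp add: adapted_domain_def)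
  ultimately show thesis using that by blast
qed

text \<open>On the adapted domain \<open>x > 0\<close>, so the Jacobian of \<open>cart\<close> is invertible; \<open>N\<close> is its inverse.\<close>

lemma pullback_cart_inject:
  assumes q: "q \<in> adapted_domain" and eq: "pullback cart b q = pullback cart b' q"
  shows "b (cart q) = b' (cart q)"
proof -
  define N :: "real^4^4" where "N = vector [vector [cos (q $ 3), sin (q $ 3), 0, 0],
                   vector [0, 0, 1, 0],
                   vector [- (sin (q $ 3) / q $ 1), cos (q $ 3) / q $ 1, 0, 0],
                   vector [0, 0, 0, 1]]"
  have JN: "cart_jacobian q ** N = mat 1"
    using q sin_cos_squared_add3[of "q $ 3"]
    by (simp add: cart_jacobian_def N_def adapted_domain_def matrix4_simps add.commute)
  have "transpose N ** pullback cart b q ** N = b (cart q)" for b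
  proof -
    have "transpose N ** pullback cart b q ** N =
        transpose (cart_jacobian q ** N) ** b (cart q) ** (cart_jacobian q ** N)"
      by (simp add: pullback_def jacobian_cart matrix_transpose_mul matrix_mul_assoc)
    then show ?thesis by (simp add: JN)
  qed
  then show ?thesis using eq by metis
qed

lemma continuous_eq_on_regular_locus:
  fixes h h' :: "real^4 \<Rightarrow> 'b::real_normed_vector"
  assumes "smooth_on UNIV h" "smooth_on UNIV h'" "\<And>p. p \<in> regular_locus \<Longrightarrow> h p = h' p"
  shows "h = h'"
proof -
  have "continuous_on UNIV h" "continuous_on UNIV h'"
    using assms(1,2) Ck_on.simps(1) unfolding smooth_on_def by blast+
  then have "closed {p. h p = h' p}"
    by (rule closed_Collect_eq)
  moreover have "regular_locus \<subseteq> {p. h p = h' p}"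
    using assms(3) by blast
  ultimately have "closure regular_locus \<subseteq> {p. h p = h' p}"
    by (rule closure_minimal[rotated])
  then show ?thesis
    by (auto simp: closure_regular_locus)
qed

text \<open>
  On the regular locus the metric is read off from its pullback, and then \<open>J\<close> from that of the
  Kaehler form, because the metric is nondegenerate. Density and continuity give the rest.
\<close>

lemma instanton_unique:
  assumes "exceptional_half_plane_instanton g J"
  shows "g = instanton_metric \<and> J = frame_endo J0"
proof
  note inst = assms[unfolded exceptional_half_plane_instanton_def]
  have g: "g p = instanton_metric p" if p: "p \<in> regular_locus" for p
  proof -
    obtain q where q: "q \<in> adapted_domain" "cart q = p"
      using cart_surj_regular_locus p by blast
    then show ?thesis
      using pullback_cart_inject[OF q(1), of g instanton_metric] inst pullback_metric by auto
  qed
  show "g = instanton_metric"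
    by (rule continuous_eq_on_regular_locus[OF _ smooth_metric[OF open_UNIV] g]) (use inst in auto)
  have J: "J p = frame_endo J0 p" if p: "p \<in> regular_locus" for p
  proof -
    obtain q where q: "q \<in> adapted_domain" "cart q = p"
      using cart_surj_regular_locus p by blast
    then have "kahler_form g J p = kahler_form instanton_metric (frame_endo J0) p"
      using pullback_cart_inject[OF q(1), of "kahler_form g J" "kahler_form instanton_metric (frame_endo J0)"]
        inst pullback_form by auto
    then have eq: "transpose (J p) ** instanton_metric p =
        transpose (frame_endo J0 p) ** instanton_metric p"
      by (simp add: kahler_form_def g[OF p])
    have "instanton_metric p ** (\<rho> p *\<^sub>R (frame p ** transpose (frame p))) = mat 1"
    proof -
      have "transpose (coframe p) ** (coframe p ** frame p) ** transpose (frame p) =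
          transpose (frame p ** coframe p)"
        by (simp add: coframe_frame matrix_transpose_mul)
      then show ?thesis
        by (simp add: instanton_metric_def matrix_mult_bilinear matrix_mul_assoc instanton.frame_coframe)
    qed
    then have cancel: "B ** instanton_metric p ** (\<rho> p *\<^sub>R (frame p ** transpose (frame p))) = B" for B
      by (simp add: matrix_mul_assoc[symmetric])
    have "transpose (J p) = transpose (frame_endo J0 p)"
      using cancel[of "transpose (J p)"] cancel[of "transpose (frame_endo J0 p)"] unfolding eq by simp
    then show ?thesis by (simp add: transpose_iff)
  qed
  show "J = frame_endo J0"
    by (rule continuous_eq_on_regular_locus[OF _ smooth_frame_endo[OF open_UNIV] J]) (use inst in auto)
qed

theorem theorem5p1:
  shows "(\<exists>!(g, J). exceptional_half_plane_instanton g J) \<and>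
    (\<forall>g J. exceptional_half_plane_instanton g J \<longrightarrow> qch_kahler_calabi_type_on UNIV g J)"
proof
  show "\<exists>!(g, J). exceptional_half_plane_instanton g J"
  proof (rule ex1I[of _ "(instanton_metric, frame_endo J0)"])
    show "case (instanton_metric, frame_endo J0) of (g, J) \<Rightarrow> exceptional_half_plane_instanton g J"
      using instanton_structure by simp
  qed (auto dest: instanton_unique)
  show "\<forall>g J. exceptional_half_plane_instanton g J \<longrightarrow> qch_kahler_calabi_type_on UNIV g J"
    using instanton_unique calabi_type by blast
qed

end
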